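(* Let $B$ be a small category. There is an equivalence of categories $$\mathbf{DFib}(B)\simeq[B^{\mathrm{op}},\mathbf{Set}].$$
   Context: $\mathbf{Cat}$ is the category of small categories. A functor $p\colon E\to B$ is a discrete fibration if for each object $e\in E$ and each arrow $f\colon b'\to pe$ in $B$ there exists a unique arrow $g\colon e'\to e$ in $E$ with codomain $e$ and $pg=f$. $\mathbf{DFib}(B)$ is the full subcategory of the slice category $\mathbf{Cat}_{/B}$ whose objects are the discrete fibrations over $B$. $[B^{\mathrm{op}},\mathbf{Set}]$ is the category of functors $B^{\mathrm{op}}\to\mathbf{Set}$ and natural transformations. *)

theory Defs
  imports "HOL-Library.FuncSet" "HOL-Library.Countable_Set"
begin

section \<open>Categories\<close>

text \<open>
  The structure maps of a category, and the maps of functors and natural transformations below,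
  are required to be \<^const>\<open>undefined\<close> outside their carriers, so that HOL equality is the
  equality of mathematics. \<open>Comp C g f\<close> is the composite "g after f".
\<close>

record ('o, 'a) cat =
  Obj :: "'o set"
  Arr :: "'a set"
  Dom :: "'a \<Rightarrow> 'o"
  Cod :: "'a \<Rightarrow> 'o"
  Id :: "'o \<Rightarrow> 'a"
  Comp :: "'a \<Rightarrow> 'a \<Rightarrow> 'a"

definition composable :: "('o, 'a) cat \<Rightarrow> 'a \<Rightarrow> 'a \<Rightarrow> bool" where
  "composable C g f \<longleftrightarrow> g \<in> Arr C \<and> f \<in> Arr C \<and> Dom C g = Cod C f"

locale category =
  fixes C :: "('o, 'a) cat"
  assumes Dom_closed: "Dom C \<in> Arr C \<rightarrow>\<^sub>E Obj C"
    and Cod_closed: "Cod C \<in> Arr C \<rightarrow>\<^sub>E Obj C"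
    and Id_closed: "Id C \<in> Obj C \<rightarrow>\<^sub>E Arr C"
    and Dom_Id: "x \<in> Obj C \<Longrightarrow> Dom C (Id C x) = x"
    and Cod_Id: "x \<in> Obj C \<Longrightarrow> Cod C (Id C x) = x"
    and Comp_closed: "composable C g f \<Longrightarrow> Comp C g f \<in> Arr C"
    and Dom_Comp: "composable C g f \<Longrightarrow> Dom C (Comp C g f) = Dom C f"
    and Cod_Comp: "composable C g f \<Longrightarrow> Cod C (Comp C g f) = Cod C g"
    and Comp_undefined: "\<not> composable C g f \<Longrightarrow> Comp C g f = undefined"
    and Comp_Id_left: "f \<in> Arr C \<Longrightarrow> Comp C (Id C (Cod C f)) f = f"
    and Comp_Id_right: "f \<in> Arr C \<Longrightarrow> Comp C f (Id C (Dom C f)) = f"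
    and Comp_assoc: "composable C h g \<Longrightarrow> composable C g f \<Longrightarrow>
      Comp C (Comp C h g) f = Comp C h (Comp C g f)"

definition hom :: "('o, 'a) cat \<Rightarrow> 'o \<Rightarrow> 'o \<Rightarrow> 'a set" where
  "hom C x y = {f \<in> Arr C. Dom C f = x \<and> Cod C f = y}"

definition isomorphic :: "('o, 'a) cat \<Rightarrow> 'o \<Rightarrow> 'o \<Rightarrow> bool" where
  "isomorphic C x y \<longleftrightarrow>
    (\<exists>f \<in> hom C x y. \<exists>g \<in> hom C y x. Comp C g f = Id C x \<and> Comp C f g = Id C y)"

definition opposite :: "('o, 'a) cat \<Rightarrow> ('o, 'a) cat" where
  "opposite C = \<lparr>Obj = Obj C, Arr = Arr C, Dom = Cod C, Cod = Dom C, Id = Id C,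
    Comp = (\<lambda>g f. Comp C f g)\<rparr>"

definition make_cat :: "'o set \<Rightarrow> 'a set \<Rightarrow> ('a \<Rightarrow> 'o) \<Rightarrow> ('a \<Rightarrow> 'o) \<Rightarrow> ('o \<Rightarrow> 'a) \<Rightarrow>
    ('a \<Rightarrow> 'a \<Rightarrow> 'a) \<Rightarrow> ('o, 'a) cat" where
  "make_cat Ob Ar dm cd i m = \<lparr>Obj = Ob, Arr = Ar, Dom = restrict dm Ar, Cod = restrict cd Ar,
    Id = restrict i Ob,
    Comp = (\<lambda>g f. if g \<in> Ar \<and> f \<in> Ar \<and> dm g = cd f then m g f else undefined)\<rparr>"

definition full_subcategory :: "('o, 'a) cat \<Rightarrow> 'o set \<Rightarrow> ('o, 'a) cat" where
  "full_subcategory C S = make_cat (Obj C \<inter> S)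
    {f \<in> Arr C. Dom C f \<in> S \<and> Cod C f \<in> S} (Dom C) (Cod C) (Id C) (Comp C)"

text \<open>
  An arrow of the slice category from \<open>p\<close> to \<open>q\<close> is a triple \<open>(p, h, q)\<close> with \<open>q h = p\<close>.
\<close>

definition slice :: "('o, 'a) cat \<Rightarrow> 'o \<Rightarrow> ('a, 'a \<times> 'a \<times> 'a) cat" where
  "slice C b = make_cat
    {p \<in> Arr C. Cod C p = b}
    {(p, h, q). p \<in> Arr C \<and> Cod C p = b \<and> q \<in> Arr C \<and> Cod C q = b \<and>
      h \<in> hom C (Dom C p) (Dom C q) \<and> Comp C q h = p}
    (\<lambda>(p, h, q). p) (\<lambda>(p, h, q). q)
    (\<lambda>p. (p, Id C (Dom C p), p))
    (\<lambda>(_, k, r) (p, h, _). (p, Comp C k h, r))"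


section \<open>Functors and natural transformations\<close>

record ('o, 'a, 'p, 'b) ftor =
  Src :: "('o, 'a) cat"
  Tgt :: "('p, 'b) cat"
  ObjMap :: "'o \<Rightarrow> 'p"
  ArrMap :: "'a \<Rightarrow> 'b"

locale is_functor =
  fixes F :: "('o, 'a, 'p, 'b) ftor"
  assumes Src_category: "category (Src F)"
    and Tgt_category: "category (Tgt F)"
    and ObjMap_closed: "ObjMap F \<in> Obj (Src F) \<rightarrow>\<^sub>E Obj (Tgt F)"
    and ArrMap_closed: "ArrMap F \<in> Arr (Src F) \<rightarrow>\<^sub>E Arr (Tgt F)"
    and ArrMap_Dom: "f \<in> Arr (Src F) \<Longrightarrow>
      Dom (Tgt F) (ArrMap F f) = ObjMap F (Dom (Src F) f)"
    and ArrMap_Cod: "f \<in> Arr (Src F) \<Longrightarrow>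
      Cod (Tgt F) (ArrMap F f) = ObjMap F (Cod (Src F) f)"
    and ArrMap_Id: "x \<in> Obj (Src F) \<Longrightarrow>
      ArrMap F (Id (Src F) x) = Id (Tgt F) (ObjMap F x)"
    and ArrMap_Comp: "composable (Src F) g f \<Longrightarrow>
      ArrMap F (Comp (Src F) g f) = Comp (Tgt F) (ArrMap F g) (ArrMap F f)"

definition functors :: "('o, 'a) cat \<Rightarrow> ('p, 'b) cat \<Rightarrow> ('o, 'a, 'p, 'b) ftor set" where
  "functors C D = {F. is_functor F \<and> Src F = C \<and> Tgt F = D}"

definition id_functor :: "('o, 'a) cat \<Rightarrow> ('o, 'a, 'o, 'a) ftor" where
  "id_functor C = \<lparr>Src = C, Tgt = C, ObjMap = restrict (\<lambda>x. x) (Obj C),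
    ArrMap = restrict (\<lambda>f. f) (Arr C)\<rparr>"

definition comp_functor :: "('p, 'b, 'q, 'c) ftor \<Rightarrow> ('o, 'a, 'p, 'b) ftor \<Rightarrow>
    ('o, 'a, 'q, 'c) ftor" where
  "comp_functor G F = \<lparr>Src = Src F, Tgt = Tgt G,
    ObjMap = compose (Obj (Src F)) (ObjMap G) (ObjMap F),
    ArrMap = compose (Arr (Src F)) (ArrMap G) (ArrMap F)\<rparr>"

record ('o, 'a, 'p, 'b) ntrans =
  NDom :: "('o, 'a, 'p, 'b) ftor"
  NCod :: "('o, 'a, 'p, 'b) ftor"
  At :: "'o \<Rightarrow> 'b"

locale is_ntrans =
  fixes C :: "('o, 'a) cat" and D :: "('p, 'b) cat" and \<alpha> :: "('o, 'a, 'p, 'b) ntrans"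
  assumes NDom_functor: "NDom \<alpha> \<in> functors C D"
    and NCod_functor: "NCod \<alpha> \<in> functors C D"
    and At_extensional: "At \<alpha> \<in> extensional (Obj C)"
    and At_closed: "x \<in> Obj C \<Longrightarrow>
      At \<alpha> x \<in> hom D (ObjMap (NDom \<alpha>) x) (ObjMap (NCod \<alpha>) x)"
    and naturality: "f \<in> Arr C \<Longrightarrow>
      Comp D (ArrMap (NCod \<alpha>) f) (At \<alpha> (Dom C f)) =
      Comp D (At \<alpha> (Cod C f)) (ArrMap (NDom \<alpha>) f)"

definition functor_category :: "('o, 'a) cat \<Rightarrow> ('p, 'b) cat \<Rightarrow>
    (('o, 'a, 'p, 'b) ftor, ('o, 'a, 'p, 'b) ntrans) cat" where
  "functor_category C D = make_cat (functors C D) {\<alpha>. is_ntrans C D \<alpha>} NDom NCod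
    (\<lambda>F. \<lparr>NDom = F, NCod = F, At = restrict (\<lambda>x. Id D (ObjMap F x)) (Obj C)\<rparr>)
    (\<lambda>\<beta> \<alpha>. \<lparr>NDom = NDom \<alpha>, NCod = NCod \<beta>,
      At = restrict (\<lambda>x. Comp D (At \<beta> x) (At \<alpha> x)) (Obj C)\<rparr>)"

definition equivalent_categories :: "('o, 'a) cat \<Rightarrow> ('p, 'b) cat \<Rightarrow> bool" where
  "equivalent_categories C D \<longleftrightarrow> category C \<and> category D \<and>
    (\<exists>F \<in> functors C D. \<exists>G \<in> functors D C.
      isomorphic (functor_category C C) (comp_functor G F) (id_functor C) \<and>
      isomorphic (functor_category D D) (comp_functor F G) (id_functor D))"


section \<open>Smallness\<close>

text \<open>
  HOL has no type of all sets, so the sets are taken to be collections of elements of a type \<open>'u\<close>,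
  and \<open>small\<close> singles out the small ones. The axioms are those closure properties of a
  Grothendieck universe that concern comprehension, replacement, unions and ordered pairs;
  power sets and infinity are not required. The lemma \<open>small_universe_material\<close> below
  shows that sets in the usual sense are an instance.
\<close>

locale small_universe =
  fixes small :: "'u set \<Rightarrow> bool"
  assumes small_subset: "small X \<Longrightarrow> Y \<subseteq> X \<Longrightarrow> small Y"
    and small_singleton: "small {x}"
    and small_image: "small X \<Longrightarrow> small ((f :: 'u \<Rightarrow> 'u) ` X)"
    and small_UN: "small I \<Longrightarrow> (\<And>i. i \<in> I \<Longrightarrow> small (A i)) \<Longrightarrow> small (\<Union>i\<in>(I :: 'u set). A i)"
    and pairing: "\<exists>pair :: 'u \<times> 'u \<Rightarrow> 'u. inj pair"

lemma small_universe_material: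
  fixes elts :: "'u \<Rightarrow> 'u set"
  assumes extensionality: "\<And>x y. elts x = elts y \<Longrightarrow> x = y"
    and pair: "\<And>x y. \<exists>z. elts z = {x, y}"
    and union: "\<And>x. \<exists>z. elts z = (\<Union>y\<in>elts x. elts y)"
    and separation: "\<And>x P. \<exists>z. elts z = {y \<in> elts x. P y}"
    and replacement: "\<And>x f. \<exists>z. elts z = f ` elts x"
  shows "small_universe (\<lambda>X. \<exists>x. X = elts x)"
proof
  show "\<exists>y. Y = elts y" if X: "\<exists>x. X = elts x" and "Y \<subseteq> X" for X Y
  proof -
    obtain x where "X = elts x" using X by blast
    then have "{y \<in> elts x. y \<in> Y} = Y" using \<open>Y \<subseteq> X\<close> by blast
    then show ?thesis using separation[of x "\<lambda>y. y \<in> Y"] by auto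
  qed
  show "\<exists>y. {x} = elts y" for x
    using pair[of x x] by auto
  show "\<exists>y. f ` X = elts y" if "\<exists>x. X = elts x" for X f
    using that replacement[where f = f] by blast
  show "\<exists>y. (\<Union>i\<in>I. A i) = elts y"
    if I: "\<exists>x. I = elts x" and A: "\<And>i. i \<in> I \<Longrightarrow> \<exists>x. A i = elts x" for I A
  proof -
    obtain a where a: "\<And>i. i \<in> I \<Longrightarrow> A i = elts (a i)" using A by metis
    obtain z where "elts z = a ` I" using I replacement by metis
    moreover obtain w where "elts w = (\<Union>y\<in>elts z. elts y)" using union by blast
    ultimately have "(\<Union>i\<in>I. A i) = elts w" using a by simp
    then show ?thesis by blast
  qed
  show "\<exists>p :: 'u \<times> 'u \<Rightarrow> 'u. inj p"
  proof -
    obtain up where up: "\<And>x y. elts (up x y) = {x, y}" using pair by metis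
    have up_eq: "up a b = up c d \<longleftrightarrow> a = c \<and> b = d \<or> a = d \<and> b = c" for a b c d
      using up[of a b] up[of c d] extensionality[of "up a b" "up c d"]
      by (metis doubleton_eq_iff)
    have "inj (\<lambda>(x, y). up (up x x) (up x y))"
      by (auto simp: inj_def up_eq)
    then show ?thesis by blast
  qed
qed

lemma small_universe_countable:
  assumes "infinite (UNIV :: 'u set)"
  shows "small_universe (countable :: 'u set \<Rightarrow> bool)"
proof
  obtain p :: "'u \<times> 'u \<Rightarrow> 'u" where "inj p"
    using card_of_Times_same_infinite[OF assms]
    by (auto simp: card_of_ordIso[symmetric] bij_betw_def)
  then show "\<exists>p :: 'u \<times> 'u \<Rightarrow> 'u. inj p" by blast
qed (auto dest: countable_subset)


section \<open>The categories of small sets, of small categories, and of discrete fibrations\<close>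

text \<open>A map of sets is a triple \<open>(X, f, Y)\<close> with \<open>f\<close> undefined outside \<open>X\<close>.\<close>

definition Set_cat :: "('u set \<Rightarrow> bool) \<Rightarrow> ('u set, 'u set \<times> ('u \<Rightarrow> 'u) \<times> 'u set) cat" where
  "Set_cat small = make_cat {X. small X}
    {(X, f, Y). small X \<and> small Y \<and> f \<in> X \<rightarrow>\<^sub>E Y}
    (\<lambda>(X, f, Y). X) (\<lambda>(X, f, Y). Y)
    (\<lambda>X. (X, restrict (\<lambda>x. x) X, X))
    (\<lambda>(_, g, Z) (X, f, _). (X, compose X g f, Z))"

definition small_category :: "('u set \<Rightarrow> bool) \<Rightarrow> ('u, 'u) cat \<Rightarrow> bool" where
  "small_category small C \<longleftrightarrow> category C \<and> small (Obj C) \<and> small (Arr C)"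

definition Cat :: "('u set \<Rightarrow> bool) \<Rightarrow> (('u, 'u) cat, ('u, 'u, 'u, 'u) ftor) cat" where
  "Cat small = make_cat {C. small_category small C}
    {F. is_functor F \<and> small_category small (Src F) \<and> small_category small (Tgt F)}
    Src Tgt id_functor comp_functor"

definition discrete_fibration :: "('o, 'a, 'p, 'b) ftor \<Rightarrow> bool" where
  "discrete_fibration p \<longleftrightarrow> is_functor p \<and>
    (\<forall>e \<in> Obj (Src p). \<forall>f \<in> Arr (Tgt p). Cod (Tgt p) f = ObjMap p e \<longrightarrow>
      (\<exists>!g. g \<in> Arr (Src p) \<and> Cod (Src p) g = e \<and> ArrMap p g = f))"

definition DFib :: "('u set \<Rightarrow> bool) \<Rightarrow> ('u, 'u) cat \<Rightarrow>
    (('u, 'u, 'u, 'u) ftor,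
      ('u, 'u, 'u, 'u) ftor \<times> ('u, 'u, 'u, 'u) ftor \<times> ('u, 'u, 'u, 'u) ftor) cat" where
  "DFib small B = full_subcategory (slice (Cat small) B) {p. discrete_fibration p}"

end

theory Submission
  imports Defs
begin

text \<open>
  Sending a discrete fibration \<open>p\<close> to the presheaf of its fibres, on which an arrow \<open>f\<close> acts by taking
  the domain of the unique lift of \<open>f\<close>, is a functor \<open>DFib(B) \<rightarrow> [B\<^sup>o\<^sup>p, Set]\<close>. It is fully faithful:
  a functor over \<open>B\<close> between discrete fibrations is determined on arrows by its values on objects,
  and naturality of a family of maps of fibres says precisely that the maps extend to arrows by
  unique lifts. It is essentially surjective because the fibres of the category of elements of
  \<open>P\<close> over \<open>B\<close> are the sets \<open>P b\<close> up to natural bijection.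
\<close>

section \<open>Categories\<close>

text \<open>The passage from presheaves back to fibrations is constructed on objects only. Its
  action on natural transformations and both natural isomorphisms of the equivalence are supplied by
  the general criterion \<open>equivalent_categoriesI\<close>. The objects of
  \<open>DFib small B\<close> have all their carriers in the single type \<open>'u\<close>, while
  the objects of a category of elements are pairs (b, x), so an injection \<open>pair\<close> codes
  pairs back into \<open>'u\<close>. The tag b cannot be dropped, since one x may lie in several
  sets \<open>ObjMap P b\<close>. With the tag, the fibre over b is a copy of
  \<open>ObjMap P b\<close> and not that set itself, so \<open>P\<close> is recovered up to
  isomorphism. Smallness enters in both directions: a fibre is a subset of the object set of a small
  category, and the category of elements is a sum of small sets indexed by the small sets
  \<open>Obj B\<close> and \<open>Arr B\<close>.\<close>

lemma make_cat_simps [simp]: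
  "Obj (make_cat Ob Ar dm cd i m) = Ob"
  "Arr (make_cat Ob Ar dm cd i m) = Ar"
  "f \<in> Ar \<Longrightarrow> Dom (make_cat Ob Ar dm cd i m) f = dm f"
  "f \<in> Ar \<Longrightarrow> Cod (make_cat Ob Ar dm cd i m) f = cd f"
  "x \<in> Ob \<Longrightarrow> Id (make_cat Ob Ar dm cd i m) x = i x"
  "g \<in> Ar \<Longrightarrow> f \<in> Ar \<Longrightarrow> dm g = cd f \<Longrightarrow> Comp (make_cat Ob Ar dm cd i m) g f = m g f"
  by (simp_all add: make_cat_def)

text \<open>The restrictions built into \<open>make_cat\<close> settle the extensionality and
  undefinedness axioms once and for all, so each instance only checks the laws on its
  carriers.\<close>

lemma category_make_cat:
  assumes "\<And>f. f \<in> Ar \<Longrightarrow> dm f \<in> Ob" "\<And>f. f \<in> Ar \<Longrightarrow> cd f \<in> Ob"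
    and "\<And>x. x \<in> Ob \<Longrightarrow> i x \<in> Ar" "\<And>x. x \<in> Ob \<Longrightarrow> dm (i x) = x" "\<And>x. x \<in> Ob \<Longrightarrow> cd (i x) = x"
    and "\<And>g f. g \<in> Ar \<Longrightarrow> f \<in> Ar \<Longrightarrow> dm g = cd f \<Longrightarrow>
      m g f \<in> Ar \<and> dm (m g f) = dm f \<and> cd (m g f) = cd g"
    and "\<And>f. f \<in> Ar \<Longrightarrow> m (i (cd f)) f = f" "\<And>f. f \<in> Ar \<Longrightarrow> m f (i (dm f)) = f"
    and "\<And>h g f. h \<in> Ar \<Longrightarrow> g \<in> Ar \<Longrightarrow> f \<in> Ar \<Longrightarrow> dm h = cd g \<Longrightarrow> dm g = cd f \<Longrightarrow>
      m (m h g) f = m h (m g f)"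
  shows "category (make_cat Ob Ar dm cd i m)"
  by unfold_locales (use assms in \<open>auto simp: make_cat_def composable_def\<close>)

lemma homI: "f \<in> Arr C \<Longrightarrow> Dom C f = x \<Longrightarrow> Cod C f = y \<Longrightarrow> f \<in> hom C x y"
  by (simp add: hom_def)

lemma homD:
  assumes "f \<in> hom C x y"
  shows "f \<in> Arr C" "Dom C f = x" "Cod C f = y"
  using assms by (simp_all add: hom_def)

context category
begin

lemma Dom_Obj [simp]: "f \<in> Arr C \<Longrightarrow> Dom C f \<in> Obj C"
  using Dom_closed by auto

lemma Cod_Obj [simp]: "f \<in> Arr C \<Longrightarrow> Cod C f \<in> Obj C"
  using Cod_closed by auto

lemma Id_Arr [simp]: "x \<in> Obj C \<Longrightarrow> Id C x \<in> Arr C"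
  using Id_closed by auto

lemma Id_hom: "x \<in> Obj C \<Longrightarrow> Id C x \<in> hom C x x"
  by (simp add: hom_def Dom_Id Cod_Id)

lemma hom_Obj: "f \<in> hom C x y \<Longrightarrow> x \<in> Obj C \<and> y \<in> Obj C"
  by (auto simp: hom_def)

lemma Comp_hom: "g \<in> hom C y z \<Longrightarrow> f \<in> hom C x y \<Longrightarrow> Comp C g f \<in> hom C x z"
  using Comp_closed Dom_Comp Cod_Comp by (simp add: hom_def composable_def)

lemma Comp_Arr:
  assumes "g \<in> Arr C" "f \<in> Arr C" "Dom C g = Cod C f"
  shows "Comp C g f \<in> Arr C" "Dom C (Comp C g f) = Dom C f" "Cod C (Comp C g f) = Cod C g"
  using assms Comp_closed Dom_Comp Cod_Comp by (simp_all add: composable_def)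

lemma Comp_assoc_hom:
  "h \<in> hom C y z \<Longrightarrow> g \<in> hom C x y \<Longrightarrow> f \<in> hom C w x \<Longrightarrow>
    Comp C (Comp C h g) f = Comp C h (Comp C g f)"
  using Comp_assoc by (simp add: hom_def composable_def)

lemma Comp_Id_hom:
  assumes "f \<in> hom C x y"
  shows "Comp C (Id C y) f = f" "Comp C f (Id C x) = f"
  using assms Comp_Id_left Comp_Id_right by (auto simp: hom_def)

lemma category_opposite: "category (opposite C)"
proof
  show "Comp (opposite C) (Comp (opposite C) h g) f = Comp (opposite C) h (Comp (opposite C) g f)"
    if "composable (opposite C) h g" "composable (opposite C) g f" for h g f
    using that Comp_assoc[of f g h] by (simp add: composable_def opposite_def)
qed (use Dom_closed Cod_closed Id_closed Dom_Id Cod_Id Comp_Id_left Comp_Id_right Comp_Arr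
    Comp_undefined in \<open>auto simp: opposite_def composable_def\<close>)

lemma category_full_subcategory: "category (full_subcategory C S)"
  unfolding full_subcategory_def
  by (rule category_make_cat)
    (use Comp_assoc in \<open>auto simp: Dom_Id Cod_Id Comp_Arr Comp_Id_left Comp_Id_right composable_def\<close>)

lemma category_slice:
  "category (slice C b)"
  unfolding slice_def
proof (rule category_make_cat, goal_cases)
  \<comment> \<open>Closure under composition: the outer triangle commutes because r (k h) = (r k) h
    = q h = p.\<close>
  case (6 g f)
  then show ?case
    by (auto intro: Comp_hom) (metis Comp_assoc_hom homI)
next
  case (9 h g f)
  then show ?case
    by (auto intro: Comp_assoc_hom)
qed (auto simp: Comp_Id_right Id_hom Comp_Id_hom)

end

lemma opposite_simps [simp]:
  "Obj (opposite C) = Obj C" "Arr (opposite C) = Arr C" "Dom (opposite C) = Cod C"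
  "Cod (opposite C) = Dom C" "Id (opposite C) = Id C" "Comp (opposite C) g f = Comp C f g"
  by (simp_all add: opposite_def)

lemma category_Set_cat: "category (Set_cat small)"
  unfolding Set_cat_def
  by (rule category_make_cat)
    (auto simp: compose_def restrict_def PiE_iff extensional_def fun_eq_iff)

lemma Set_cat_simps [simp]:
  "Obj (Set_cat small) = {X. small X}"
  "(X, f, Y) \<in> Arr (Set_cat small) \<longleftrightarrow> small X \<and> small Y \<and> f \<in> X \<rightarrow>\<^sub>E Y"
  "(X, f, Y) \<in> Arr (Set_cat small) \<Longrightarrow> Dom (Set_cat small) (X, f, Y) = X"
  "(X, f, Y) \<in> Arr (Set_cat small) \<Longrightarrow> Cod (Set_cat small) (X, f, Y) = Y"
  "small X \<Longrightarrow> Id (Set_cat small) X = (X, restrict (\<lambda>x. x) X, X)"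
  "(X, f, Y) \<in> Arr (Set_cat small) \<Longrightarrow> (Y, g, Z) \<in> Arr (Set_cat small) \<Longrightarrow>
    Comp (Set_cat small) (Y, g, Z) (X, f, Y) = (X, compose X g f, Z)"
  by (auto simp: Set_cat_def)

lemma hom_Set_cat:
  "hom (Set_cat small) X Y = {(X', f, Y'). X' = X \<and> Y' = Y \<and> small X \<and> small Y \<and> f \<in> X \<rightarrow>\<^sub>E Y}"
  by (force simp: hom_def Set_cat_def)


section \<open>Functors\<close>

lemma functors_iff: "F \<in> functors C D \<longleftrightarrow> is_functor F \<and> Src F = C \<and> Tgt F = D"
  by (simp add: functors_def)

text \<open>Both functors are undefined off their carriers, so agreement on the carriers is equality
  of records. The unit and associativity laws of \<open>Cat\<close> are checked this way.\<close>

lemma functor_eqI: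
  assumes "F \<in> functors C D" "G \<in> functors C D"
    and "\<And>x. x \<in> Obj C \<Longrightarrow> ObjMap F x = ObjMap G x" "\<And>f. f \<in> Arr C \<Longrightarrow> ArrMap F f = ArrMap G f"
  shows "F = G"
proof -
  have maps: "ObjMap F \<in> Obj C \<rightarrow>\<^sub>E Obj D" "ObjMap G \<in> Obj C \<rightarrow>\<^sub>E Obj D"
    "ArrMap F \<in> Arr C \<rightarrow>\<^sub>E Arr D" "ArrMap G \<in> Arr C \<rightarrow>\<^sub>E Arr D"
    using assms(1,2) by (auto simp only: functors_def is_functor_def)
  have "ObjMap F = ObjMap G"
    by (rule PiE_ext[OF maps(1,2) assms(3)])
  moreover have "ArrMap F = ArrMap G"
    by (rule PiE_ext[OF maps(3,4) assms(4)])
  ultimately show ?thesis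
    using assms by (simp add: functors_def)
qed

context is_functor
begin

lemma ObjMap_Obj [simp]: "x \<in> Obj (Src F) \<Longrightarrow> ObjMap F x \<in> Obj (Tgt F)"
  using ObjMap_closed by auto

lemma ArrMap_Arr [simp]: "f \<in> Arr (Src F) \<Longrightarrow> ArrMap F f \<in> Arr (Tgt F)"
  using ArrMap_closed by auto

end

lemma functor_hom:
  "F \<in> functors C D \<Longrightarrow> f \<in> hom C x y \<Longrightarrow> ArrMap F f \<in> hom D (ObjMap F x) (ObjMap F y)"
  using is_functor.ArrMap_Arr[of F f] is_functor.ArrMap_Dom[of F f] is_functor.ArrMap_Cod[of F f]
  by (auto simp: hom_def functors_def)

lemma functor_Comp:
  "F \<in> functors C D \<Longrightarrow> g \<in> hom C y z \<Longrightarrow> f \<in> hom C x y \<Longrightarrow>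
    ArrMap F (Comp C g f) = Comp D (ArrMap F g) (ArrMap F f)"
  using is_functor.ArrMap_Comp[of F g f] by (auto simp: hom_def functors_def composable_def)

lemma functor_Id: "F \<in> functors C D \<Longrightarrow> x \<in> Obj C \<Longrightarrow> ArrMap F (Id C x) = Id D (ObjMap F x)"
  using is_functor.ArrMap_Id[of F x] by (auto simp: functors_def)

lemma functor_Obj: "F \<in> functors C D \<Longrightarrow> x \<in> Obj C \<Longrightarrow> ObjMap F x \<in> Obj D"
  using is_functor.ObjMap_Obj[of F x] by (auto simp: functors_def)

text \<open>Stated with hom-sets: one typing hypothesis then covers closure and the preservation of
  domains and codomains together.\<close>

lemma functorI:
  assumes C: "category C" and D: "category D"
    and "\<And>x. x \<in> Obj C \<Longrightarrow> FO x \<in> Obj D"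
    and hom: "\<And>x y f. f \<in> hom C x y \<Longrightarrow> FA f \<in> hom D (FO x) (FO y)"
    and "\<And>x. x \<in> Obj C \<Longrightarrow> FA (Id C x) = Id D (FO x)"
    and "\<And>x y z f g. g \<in> hom C y z \<Longrightarrow> f \<in> hom C x y \<Longrightarrow> FA (Comp C g f) = Comp D (FA g) (FA f)"
  shows "\<lparr>Src = C, Tgt = D, ObjMap = restrict FO (Obj C), ArrMap = restrict FA (Arr C)\<rparr>
    \<in> functors C D" (is "?F \<in> _")
proof -
  interpret C: category C by fact
  interpret D: category D by fact
  have *: "FA f \<in> Arr D" "Dom D (FA f) = FO (Dom C f)" "Cod D (FA f) = FO (Cod C f)"
    if "f \<in> Arr C" for f
    using hom[OF homI[OF that refl refl]] by (auto simp: hom_def)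
  have "is_functor ?F"
    by (rule is_functor.intro)
      (use assms in \<open>auto simp: * hom_def composable_def C.Comp_Arr\<close>)
  then show ?thesis
    by (simp add: functors_def)
qed

lemma id_functor_functors: "category C \<Longrightarrow> id_functor C \<in> functors C C"
  unfolding id_functor_def by (rule functorI) auto

lemma id_functor_simps [simp]:
  "Src (id_functor C) = C" "Tgt (id_functor C) = C"
  "x \<in> Obj C \<Longrightarrow> ObjMap (id_functor C) x = x" "f \<in> Arr C \<Longrightarrow> ArrMap (id_functor C) f = f"
  by (simp_all add: id_functor_def)

lemma comp_functor_simps [simp]:
  "Src (comp_functor G F) = Src F" "Tgt (comp_functor G F) = Tgt G"
  "x \<in> Obj (Src F) \<Longrightarrow> ObjMap (comp_functor G F) x = ObjMap G (ObjMap F x)"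
  "f \<in> Arr (Src F) \<Longrightarrow> ArrMap (comp_functor G F) f = ArrMap G (ArrMap F f)"
  by (simp_all add: comp_functor_def compose_def)

lemma comp_functor_functors:
  assumes "F \<in> functors C D" "G \<in> functors D E"
  shows "comp_functor G F \<in> functors C E"
proof -
  have [simp]: "Src F = C" "Tgt G = E"
    using assms by (auto simp: functors_def)
  have "category C" "category E"
    using assms by (auto simp: functors_def is_functor_def)
  then show ?thesis
    unfolding comp_functor_def compose_def
    by simp (rule functorI; use assms in \<open>auto intro: functor_Obj functor_hom
        simp: functor_Id functor_Obj functor_Comp functor_Comp[OF assms(2) functor_hom functor_hom]\<close>)
qed

lemma category_Cat: "category (Cat small)"
  unfolding Cat_def
proof (rule category_make_cat, goal_cases)
  case (3 C)
  then show ?case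
    using id_functor_functors[of C] by (simp add: small_category_def functors_def)
next
  case (6 G F)
  then show ?case
    using comp_functor_functors[of F _ _ G] by (simp add: functors_def)
next
  case (7 F)
  then have "F \<in> functors (Src F) (Tgt F)" "category (Tgt F)"
    by (simp_all add: functors_def small_category_def)
  then show ?case
    using comp_functor_functors[OF _ id_functor_functors, of F "Src F" "Tgt F"]
    by (intro functor_eqI[of _ "Src F" "Tgt F"]) (auto simp: functor_Obj functors_iff is_functor.ArrMap_Arr)
next
  case (8 F)
  then have "F \<in> functors (Src F) (Tgt F)" "category (Src F)"
    by (simp_all add: functors_def small_category_def)
  then show ?case
    using comp_functor_functors[OF id_functor_functors, of "Src F" F "Tgt F"]
    by (intro functor_eqI[of _ "Src F" "Tgt F"]) (auto simp: functor_Obj)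
next
  case (9 H G F)
  then have "F \<in> functors (Src F) (Src G)" "G \<in> functors (Src G) (Src H)" "H \<in> functors (Src H) (Tgt H)"
    by (simp_all add: functors_def)
  then show ?case
    using 9 by (intro functor_eqI[of _ "Src F" "Tgt H"] comp_functor_functors)
      (auto simp: functor_Obj functors_iff is_functor.ArrMap_Arr)
qed (simp_all add: id_functor_def)


section \<open>Natural transformations\<close>

lemma (in is_ntrans) ntrans_categories: "category C" "category D"
  using NDom_functor by (auto simp: functors_def is_functor_def)

lemma ntrans_eqI:
  assumes "is_ntrans C D \<alpha>" "is_ntrans C D \<beta>" "NDom \<alpha> = NDom \<beta>" "NCod \<alpha> = NCod \<beta>"
    and "\<And>x. x \<in> Obj C \<Longrightarrow> At \<alpha> x = At \<beta> x"
  shows "\<alpha> = \<beta>"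
proof -
  have "At \<alpha> = At \<beta>"
    using assms by (intro extensionalityI[of _ "Obj C"]) (auto simp: is_ntrans_def)
  then show ?thesis
    using assms by simp
qed

lemma ntransI:
  assumes "F \<in> functors C D" "G \<in> functors C D"
    and "\<And>x. x \<in> Obj C \<Longrightarrow> a x \<in> hom D (ObjMap F x) (ObjMap G x)"
    and "\<And>x y f. f \<in> hom C x y \<Longrightarrow>
      Comp D (ArrMap G f) (a x) = Comp D (a y) (ArrMap F f)"
  shows "is_ntrans C D \<lparr>NDom = F, NCod = G, At = restrict a (Obj C)\<rparr>"
proof -
  interpret category C
    using assms by (auto simp: functors_def is_functor_def)
  show ?thesis
    by unfold_locales (use assms in \<open>auto simp: hom_def\<close>)
qed

text \<open>The naturality square of the composite is the pasting of the squares of \<alpha> and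
  \<beta>; everything else in the calculation is reassociation.\<close>

lemma ntrans_Comp:
  assumes \<alpha>: "is_ntrans C D \<alpha>" and \<beta>: "is_ntrans C D \<beta>" and eq: "NDom \<beta> = NCod \<alpha>"
  shows "is_ntrans C D \<lparr>NDom = NDom \<alpha>, NCod = NCod \<beta>,
    At = restrict (\<lambda>x. Comp D (At \<beta> x) (At \<alpha> x)) (Obj C)\<rparr>"
proof -
  interpret \<alpha>: is_ntrans C D \<alpha> by fact
  interpret \<beta>: is_ntrans C D \<beta> by fact
  interpret C: category C using \<alpha>.ntrans_categories(1) .
  interpret D: category D using \<alpha>.ntrans_categories(2) .
  show ?thesis
  proof (rule ntransI[OF \<alpha>.NDom_functor \<beta>.NCod_functor])
    show "Comp D (At \<beta> x) (At \<alpha> x) \<in> hom D (ObjMap (NDom \<alpha>) x) (ObjMap (NCod \<beta>) x)"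
      if "x \<in> Obj C" for x
      using that \<alpha>.At_closed \<beta>.At_closed eq by (auto intro: D.Comp_hom)
    show "Comp D (ArrMap (NCod \<beta>) f) (Comp D (At \<beta> x) (At \<alpha> x)) =
        Comp D (Comp D (At \<beta> y) (At \<alpha> y)) (ArrMap (NDom \<alpha>) f)" if f: "f \<in> hom C x y" for x y f
    proof -
      have xy: "x \<in> Obj C" "y \<in> Obj C" using C.hom_Obj[OF f] by auto
      note a = \<alpha>.At_closed[OF xy(1)] \<alpha>.At_closed[OF xy(2)]
      note b = \<beta>.At_closed[OF xy(1)] \<beta>.At_closed[OF xy(2)]
      note F = functor_hom[OF \<alpha>.NDom_functor f] functor_hom[OF \<alpha>.NCod_functor f]
        functor_hom[OF \<beta>.NCod_functor f]
      have "Comp D (ArrMap (NCod \<beta>) f) (Comp D (At \<beta> x) (At \<alpha> x)) =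
          Comp D (Comp D (ArrMap (NCod \<beta>) f) (At \<beta> x)) (At \<alpha> x)"
        using a b F eq by (simp add: D.Comp_assoc_hom)
      also have "\<dots> = Comp D (Comp D (At \<beta> y) (ArrMap (NCod \<alpha>) f)) (At \<alpha> x)"
        using \<beta>.naturality f eq by (auto simp: hom_def)
      also have "\<dots> = Comp D (At \<beta> y) (Comp D (ArrMap (NCod \<alpha>) f) (At \<alpha> x))"
        using a b F eq by (simp add: D.Comp_assoc_hom)
      also have "\<dots> = Comp D (At \<beta> y) (Comp D (At \<alpha> y) (ArrMap (NDom \<alpha>) f))"
        using \<alpha>.naturality f by (auto simp: hom_def)
      also have "\<dots> = Comp D (Comp D (At \<beta> y) (At \<alpha> y)) (ArrMap (NDom \<alpha>) f)"
        using a b F eq by (simp add: D.Comp_assoc_hom)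
      finally show ?thesis .
    qed
  qed
qed

lemma ntrans_Id:
  assumes F: "F \<in> functors C D"
  shows "is_ntrans C D \<lparr>NDom = F, NCod = F, At = restrict (\<lambda>x. Id D (ObjMap F x)) (Obj C)\<rparr>"
proof -
  interpret D: category D
    using assms by (auto simp: functors_def is_functor_def)
  show ?thesis
    by (rule ntransI[OF F F])
      (auto simp: D.Id_hom functor_Obj[OF F] D.Comp_Id_hom[OF functor_hom[OF F]])
qed

lemma category_functor_category: "category (functor_category C D)"
  unfolding functor_category_def
proof (rule category_make_cat, goal_cases)
  case (7 \<alpha>)
  then interpret is_ntrans C D \<alpha> by simp
  interpret D: category D using ntrans_categories(2) .
  show ?case
    using ntrans_Comp[OF is_ntrans_axioms ntrans_Id[OF NCod_functor]] is_ntrans_axioms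
    by (intro ntrans_eqI[of C D]) (auto simp: D.Comp_Id_hom[OF At_closed] cong: restrict_cong)
next
  case (8 \<alpha>)
  then interpret is_ntrans C D \<alpha> by simp
  interpret D: category D using ntrans_categories(2) .
  show ?case
    using ntrans_Comp[OF ntrans_Id[OF NDom_functor] is_ntrans_axioms] is_ntrans_axioms
    by (intro ntrans_eqI[of C D]) (auto simp: D.Comp_Id_hom[OF At_closed] cong: restrict_cong)
next
  case (9 \<gamma> \<beta> \<alpha>)
  then interpret \<alpha>: is_ntrans C D \<alpha> by simp
  interpret \<beta>: is_ntrans C D \<beta> using 9 by simp
  interpret \<gamma>: is_ntrans C D \<gamma> using 9 by simp
  interpret D: category D using \<alpha>.ntrans_categories(2) .
  have "Comp D (Comp D (At \<gamma> x) (At \<beta> x)) (At \<alpha> x) = Comp D (At \<gamma> x) (Comp D (At \<beta> x) (At \<alpha> x))"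
    if "x \<in> Obj C" for x
    using that 9 \<alpha>.At_closed[of x] \<beta>.At_closed[of x] \<gamma>.At_closed[of x]
    by (auto intro: D.Comp_assoc_hom)
  then show ?case
    by (auto intro: restrict_ext)
qed (auto simp: ntrans_Id ntrans_Comp is_ntrans.NDom_functor is_ntrans.NCod_functor)

text \<open>Pointwise inverses b are automatically natural: b_y G(f) = b_y G(f) \<alpha>_x b_x = b_y
  \<alpha>_y F(f) b_x = F(f) b_x. Hence an isomorphism of functors only needs one natural family
  with invertible components; unit, counit and the comparison of fibres with \<open>P\<close> are
  all obtained so.\<close>

lemma isomorphic_functor_categoryI:
  assumes \<alpha>: "is_ntrans C D \<alpha>" and F: "NDom \<alpha> = F" and G: "NCod \<alpha> = G"
    and inv: "\<And>x. x \<in> Obj C \<Longrightarrow> \<exists>g \<in> hom D (ObjMap G x) (ObjMap F x).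
      Comp D g (At \<alpha> x) = Id D (ObjMap F x) \<and> Comp D (At \<alpha> x) g = Id D (ObjMap G x)"
  shows "isomorphic (functor_category C D) F G"
proof -
  interpret is_ntrans C D \<alpha> by fact
  interpret C: category C using ntrans_categories(1) .
  interpret D: category D using ntrans_categories(2) .
  obtain b where b: "\<And>x. x \<in> Obj C \<Longrightarrow> b x \<in> hom D (ObjMap G x) (ObjMap F x)"
    and b1: "\<And>x. x \<in> Obj C \<Longrightarrow> Comp D (b x) (At \<alpha> x) = Id D (ObjMap F x)"
    and b2: "\<And>x. x \<in> Obj C \<Longrightarrow> Comp D (At \<alpha> x) (b x) = Id D (ObjMap G x)"
    using inv by metis
  note FF = NDom_functor[unfolded F] and GG = NCod_functor[unfolded G]
  note a = At_closed[unfolded F G]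
  let ?\<beta> = "\<lparr>NDom = G, NCod = F, At = restrict b (Obj C)\<rparr>"
  have \<beta>: "is_ntrans C D ?\<beta>"
  proof (rule ntransI[OF GG FF b])
    show "Comp D (ArrMap F f) (b x) = Comp D (b y) (ArrMap G f)" if f: "f \<in> hom C x y" for x y f
    proof -
      have xy: "x \<in> Obj C" "y \<in> Obj C" using C.hom_Obj[OF f] by auto
      note h = a[OF xy(1)] a[OF xy(2)] b[OF xy(1)] b[OF xy(2)] functor_hom[OF FF f] functor_hom[OF GG f]
      have "Comp D (ArrMap F f) (b x) = Comp D (Comp D (Comp D (b y) (At \<alpha> y)) (ArrMap F f)) (b x)"
        using h b1[OF xy(2)] by (simp add: D.Comp_Id_hom)
      also have "\<dots> = Comp D (b y) (Comp D (Comp D (At \<alpha> y) (ArrMap F f)) (b x))"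
        using D.Comp_assoc_hom[OF h(4,2,5)]
          D.Comp_assoc_hom[OF h(4) D.Comp_hom[OF h(2,5)] h(3)]
        by simp
      also have "\<dots> = Comp D (b y) (Comp D (Comp D (ArrMap G f) (At \<alpha> x)) (b x))"
        using naturality f F G by (auto simp: hom_def)
      also have "\<dots> = Comp D (b y) (Comp D (ArrMap G f) (Comp D (At \<alpha> x) (b x)))"
        using D.Comp_assoc_hom[OF h(6) h(1) h(3)] by simp
      also have "\<dots> = Comp D (b y) (ArrMap G f)"
        using h b2[OF xy(1)] by (simp add: D.Comp_Id_hom)
      finally show ?thesis .
    qed
  qed
  show ?thesis
    unfolding isomorphic_def
  proof (intro bexI conjI)
    show "\<alpha> \<in> hom (functor_category C D) F G" "?\<beta> \<in> hom (functor_category C D) G F"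
      using \<alpha> \<beta> F G by (simp_all add: functor_category_def hom_def)
    show "Comp (functor_category C D) ?\<beta> \<alpha> = Id (functor_category C D) F"
      "Comp (functor_category C D) \<alpha> ?\<beta> = Id (functor_category C D) G"
      using \<alpha> \<beta> F G FF GG b1 b2 by (simp_all add: functor_category_def cong: restrict_cong)
  qed
qed


section \<open>Fully faithful and essentially surjective functors\<close>

text \<open>The weak inverse comes from choice: an object g d with an isomorphism e_d from F(g d) to
  d for each d, and on an arrow u from x to y the unique preimage under \<open>F\<close> of the
  conjugate of u by e_x and e_y.\<close>

lemma equivalent_categoriesI:
  assumes F: "F \<in> functors C D"
    and ff: "\<And>x y. x \<in> Obj C \<Longrightarrow> y \<in> Obj C \<Longrightarrow>
      bij_betw (ArrMap F) (hom C x y) (hom D (ObjMap F x) (ObjMap F y))"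
    and eso: "\<And>d. d \<in> Obj D \<Longrightarrow> \<exists>c \<in> Obj C. isomorphic D (ObjMap F c) d"
  shows "equivalent_categories C D"
proof -
  interpret C: category C using F by (auto simp: functors_def is_functor_def)
  interpret D: category D using F by (auto simp: functors_def is_functor_def)
  have [simp]: "Src F = C" "Tgt F = D"
    using F by (auto simp: functors_def)
  note FO = functor_Obj[OF F] and FH = functor_hom[OF F]
  have "\<exists>c e e'. c \<in> Obj C \<and> e \<in> hom D (ObjMap F c) d \<and> e' \<in> hom D d (ObjMap F c) \<and>
      Comp D e' e = Id D (ObjMap F c) \<and> Comp D e e' = Id D d" if "d \<in> Obj D" for d
    using eso[OF that] unfolding isomorphic_def by blast
  then obtain g e e' where g: "\<And>d. d \<in> Obj D \<Longrightarrow> g d \<in> Obj C"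
    and e: "\<And>d. d \<in> Obj D \<Longrightarrow> e d \<in> hom D (ObjMap F (g d)) d"
    and e': "\<And>d. d \<in> Obj D \<Longrightarrow> e' d \<in> hom D d (ObjMap F (g d))"
    and e'e: "\<And>d. d \<in> Obj D \<Longrightarrow> Comp D (e' d) (e d) = Id D (ObjMap F (g d))"
    and ee': "\<And>d. d \<in> Obj D \<Longrightarrow> Comp D (e d) (e' d) = Id D d"
    by metis
  define L where "L x y = inv_into (hom C x y) (ArrMap F)" for x y
  have L: "L x y u \<in> hom C x y" "ArrMap F (L x y u) = u"
    if "x \<in> Obj C" "y \<in> Obj C" "u \<in> hom D (ObjMap F x) (ObjMap F y)" for x y u
    using ff[OF that(1,2)] that(3) unfolding L_def bij_betw_def
    by (auto intro: inv_into_into f_inv_into_f)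
  have faithful: "u = v" if "u \<in> hom C x y" "v \<in> hom C x y" "ArrMap F u = ArrMap F v" for u v x y
    using ff[of x y] that C.hom_Obj by (auto simp: bij_betw_def inj_on_def)
  \<comment> \<open>The conjugate of u by the chosen isomorphisms. The second claim below is exactly
    the naturality of \<open>e\<close> with respect to it.\<close>
  define t where "t u = Comp D (e' (Cod D u)) (Comp D u (e (Dom D u)))" for u
  have t: "t u \<in> hom D (ObjMap F (g x)) (ObjMap F (g y))" "Comp D (e y) (t u) = Comp D u (e x)"
    if u: "u \<in> hom D x y" for u x y
  proof -
    have xy: "x \<in> Obj D" "y \<in> Obj D" using D.hom_Obj[OF u] by auto
    have ue: "Comp D u (e x) \<in> hom D (ObjMap F (g x)) y"
      using u e[OF xy(1)] by (rule D.Comp_hom)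
    have tu: "t u = Comp D (e' y) (Comp D u (e x))"
      using homD[OF u] by (simp add: t_def)
    show "t u \<in> hom D (ObjMap F (g x)) (ObjMap F (g y))"
      unfolding tu using e'[OF xy(2)] ue by (rule D.Comp_hom)
    have "Comp D (e y) (t u) = Comp D (Comp D (e y) (e' y)) (Comp D u (e x))"
      unfolding tu using D.Comp_assoc_hom[OF e[OF xy(2)] e'[OF xy(2)] ue] by simp
    then show "Comp D (e y) (t u) = Comp D u (e x)"
      using ue by (simp add: ee'[OF xy(2)] D.Comp_Id_hom)
  qed
  \<comment> \<open>Left cancellation of \<open>e d\<close> lets equations between arrows into F(g
    d) be tested after composing with \<open>e d\<close>, where \<open>t(2)\<close> moves
    \<open>t\<close> out of the way. This gives functoriality of \<open>t\<close>, and faithfulness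
    of \<open>F\<close> then gives that of \<open>GA\<close>.\<close>
  have mono: "u = v" if "u \<in> hom D x (ObjMap F (g d))" "v \<in> hom D x (ObjMap F (g d))"
      "Comp D (e d) u = Comp D (e d) v" "d \<in> Obj D" for u v x d
  proof -
    have "w = Comp D (e' d) (Comp D (e d) w)" if "w \<in> hom D x (ObjMap F (g d))" for w
      using D.Comp_assoc_hom[OF e' e that] that \<open>d \<in> Obj D\<close> by (simp add: e'e D.Comp_Id_hom)
    then show ?thesis
      using that by metis
  qed
  define GA where "GA u = L (g (Dom D u)) (g (Cod D u)) (t u)" for u
  have GA: "GA u \<in> hom C (g x) (g y)" "ArrMap F (GA u) = t u" if "u \<in> hom D x y" for u x y
    using L[OF g g t(1)[OF that]] D.hom_Obj[OF that] that by (auto simp: GA_def hom_def)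
  define G where "G = \<lparr>Src = D, Tgt = C, ObjMap = restrict g (Obj D), ArrMap = restrict GA (Arr D)\<rparr>"
  have G: "G \<in> functors D C"
    unfolding G_def
  proof (rule functorI)
    fix x assume x: "x \<in> Obj D"
    have "t (Id D x) = Id D (ObjMap F (g x))"
      using x by (intro mono[OF t(1)[OF D.Id_hom]])
        (auto simp: t(2)[OF D.Id_hom] D.Id_hom g FO D.Comp_Id_hom[OF e])
    then show "GA (Id D x) = Id C (g x)"
      using x GA[OF D.Id_hom[OF x]] by (intro faithful) (auto simp: C.Id_hom g functor_Id[OF F])
  next
    fix x y z f h assume f: "f \<in> hom D x y" and h: "h \<in> hom D y z"
    have xyz: "x \<in> Obj D" "y \<in> Obj D" "z \<in> Obj D"
      using D.hom_Obj f h by auto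
    note hf = D.Comp_hom[OF h f]
    have "Comp D (e z) (Comp D (t h) (t f)) = Comp D (Comp D (e z) (t h)) (t f)"
      using D.Comp_assoc_hom[OF e t(1)[OF h] t(1)[OF f]] xyz by simp
    also have "\<dots> = Comp D h (Comp D (e y) (t f))"
      using D.Comp_assoc_hom[OF h e t(1)[OF f]] t(2)[OF h] xyz by simp
    also have "\<dots> = Comp D (Comp D h f) (e x)"
      using D.Comp_assoc_hom[OF h f e] t(2)[OF f] xyz by simp
    finally have "t (Comp D h f) = Comp D (t h) (t f)"
      using xyz by (intro mono[OF t(1)[OF hf] D.Comp_hom[OF t(1)[OF h] t(1)[OF f]]])
        (simp_all add: t(2)[OF hf])
    then show "GA (Comp D h f) = Comp C (GA h) (GA f)"
      using GA[OF h] GA[OF f] GA[OF hf]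
      by (intro faithful[OF _ C.Comp_hom]) (auto simp: functor_Comp[OF F])
  qed (use g GA in \<open>auto intro: C.category_axioms D.category_axioms\<close>)
  have [simp]: "Src G = D" "Tgt G = C" "\<And>d. d \<in> Obj D \<Longrightarrow> ObjMap G d = g d"
    "\<And>u. u \<in> Arr D \<Longrightarrow> ArrMap G u = GA u"
    by (simp_all add: G_def)
  note GF = comp_functor_functors[OF F G] and FG = comp_functor_functors[OF G F]
  have counit: "isomorphic (functor_category D D) (comp_functor F G) (id_functor D)"
  proof (rule isomorphic_functor_categoryI)
    show "is_ntrans D D \<lparr>NDom = comp_functor F G, NCod = id_functor D, At = restrict e (Obj D)\<rparr>"
    proof (rule ntransI[OF FG id_functor_functors])
      fix x y u assume u: "u \<in> hom D x y"
      then show "Comp D (ArrMap (id_functor D) u) (e x) = Comp D (e y) (ArrMap (comp_functor F G) u)"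
        using t(2)[OF u] GA(2)[OF u] homD[OF u] by simp
    qed (simp_all add: e D.category_axioms)
    show "\<exists>k \<in> hom D (ObjMap (id_functor D) x) (ObjMap (comp_functor F G) x).
        Comp D k (At \<lparr>NDom = comp_functor F G, NCod = id_functor D, At = restrict e (Obj D)\<rparr> x) =
          Id D (ObjMap (comp_functor F G) x) \<and>
        Comp D (At \<lparr>NDom = comp_functor F G, NCod = id_functor D, At = restrict e (Obj D)\<rparr> x) k =
          Id D (ObjMap (id_functor D) x)" if "x \<in> Obj D" for x
      using that e' e'e ee' by (intro bexI[of _ "e' x"]) auto
  qed simp_all
  \<comment> \<open>The counit at F(x) is an arrow from F(g(F x)) to F(x), so by fullness it is the
    image of an arrow \<open>h x\<close>. The preimage of its inverse is inverse to
    \<open>h x\<close> by faithfulness.\<close>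
  define h where "h x = L (g (ObjMap F x)) x (e (ObjMap F x))" for x
  have h: "h x \<in> hom C (g (ObjMap F x)) x" "ArrMap F (h x) = e (ObjMap F x)" if "x \<in> Obj C" for x
    using L[OF g[OF FO] _ e[OF FO]] that by (auto simp: h_def)
  define h' where "h' x = L x (g (ObjMap F x)) (e' (ObjMap F x))" for x
  have h': "h' x \<in> hom C x (g (ObjMap F x))" "ArrMap F (h' x) = e' (ObjMap F x)" if "x \<in> Obj C" for x
    using L[OF _ g[OF FO] e'[OF FO]] that by (auto simp: h'_def)
  have h'h: "Comp C (h' x) (h x) = Id C (g (ObjMap F x))"
    and hh': "Comp C (h x) (h' x) = Id C x" if x: "x \<in> Obj C" for x
    using h[OF x] h'[OF x] x FO[OF x] g[OF FO[OF x]]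
    by (auto intro!: faithful[OF C.Comp_hom C.Id_hom]
        simp: functor_Comp[OF F] functor_Id[OF F] e'e ee')
  have unit: "isomorphic (functor_category C C) (comp_functor G F) (id_functor C)"
  proof (rule isomorphic_functor_categoryI)
    show "is_ntrans C C \<lparr>NDom = comp_functor G F, NCod = id_functor C, At = restrict h (Obj C)\<rparr>"
    proof (rule ntransI[OF GF id_functor_functors])
      fix x y u assume u: "u \<in> hom C x y"
      have xy: "x \<in> Obj C" "y \<in> Obj C" using C.hom_Obj[OF u] by auto
      note Fu = FH[OF u]
      \<comment> \<open>After applying \<open>F\<close>, naturality of \<open>h\<close> becomes the
        naturality of \<open>e\<close> at F(u).\<close>
      have "ArrMap F (Comp C u (h x)) = ArrMap F (Comp C (h y) (GA (ArrMap F u)))"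
        using functor_Comp[OF F u h(1)[OF xy(1)]] functor_Comp[OF F h(1)[OF xy(2)] GA(1)[OF Fu]]
          t(2)[OF Fu] xy by (simp add: h(2) GA(2)[OF Fu])
      then have "Comp C u (h x) = Comp C (h y) (GA (ArrMap F u))"
        by (rule faithful[OF C.Comp_hom[OF u h(1)[OF xy(1)]] C.Comp_hom[OF h(1)[OF xy(2)] GA(1)[OF Fu]]])
      then show "Comp C (ArrMap (id_functor C) u) (h x) = Comp C (h y) (ArrMap (comp_functor G F) u)"
        using homD[OF u] homD[OF Fu] by simp
    qed (simp_all add: h FO C.category_axioms)
    show "\<exists>k \<in> hom C (ObjMap (id_functor C) x) (ObjMap (comp_functor G F) x).
        Comp C k (At \<lparr>NDom = comp_functor G F, NCod = id_functor C, At = restrict h (Obj C)\<rparr> x) =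
          Id C (ObjMap (comp_functor G F) x) \<and>
        Comp C (At \<lparr>NDom = comp_functor G F, NCod = id_functor C, At = restrict h (Obj C)\<rparr> x) k =
          Id C (ObjMap (id_functor C) x)" if "x \<in> Obj C" for x
      using that h' h'h hh' FO by (intro bexI[of _ "h' x"]) auto
  qed simp_all
  show ?thesis
    unfolding equivalent_categories_def
    using F G unit counit C.category_axioms D.category_axioms by blast
qed


section \<open>Discrete fibrations\<close>

definition lift :: "('o, 'a, 'p, 'b) ftor \<Rightarrow> 'o \<Rightarrow> 'b \<Rightarrow> 'a" where
  "lift p e f = (THE g. g \<in> Arr (Src p) \<and> Cod (Src p) g = e \<and> ArrMap p g = f)"

definition fibre :: "('o, 'a, 'p, 'b) ftor \<Rightarrow> 'p \<Rightarrow> 'o set" where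
  "fibre p b = {e \<in> Obj (Src p). ObjMap p e = b}"

text \<open>The reindexing of fibres usually written f^* e, from the fibre over the codomain of f to
  the fibre over its domain.\<close>

definition pull :: "('o, 'a, 'p, 'b) ftor \<Rightarrow> 'b \<Rightarrow> 'o \<Rightarrow> 'o" where
  "pull p f e = Dom (Src p) (lift p e f)"

locale dfib =
  fixes p :: "('o, 'a, 'p, 'b) ftor" and E :: "('o, 'a) cat" and B :: "('p, 'b) cat"
  assumes discrete_fibration: "discrete_fibration p" and Src: "Src p = E" and Tgt: "Tgt p = B"
begin

sublocale F: is_functor p
  using discrete_fibration by (simp add: discrete_fibration_def)

lemma p: "p \<in> functors E B"
  using Src Tgt F.is_functor_axioms by (simp add: functors_def)

sublocale E: category E
  using F.Src_category Src by simp

sublocale B: category B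
  using F.Tgt_category Tgt by simp

lemma mem_fibre: "e \<in> fibre p b \<longleftrightarrow> e \<in> Obj E \<and> ObjMap p e = b"
  by (auto simp: fibre_def Src)

lemma ArrMap_p:
  assumes "f \<in> Arr E"
  shows "ArrMap p f \<in> Arr B" "Dom B (ArrMap p f) = ObjMap p (Dom E f)"
    "Cod B (ArrMap p f) = ObjMap p (Cod E f)"
  using assms F.ArrMap_Arr F.ArrMap_Dom F.ArrMap_Cod Src Tgt by auto

lemma lift_ex1:
  "e \<in> fibre p b \<Longrightarrow> f \<in> Arr B \<Longrightarrow> Cod B f = b \<Longrightarrow>
    \<exists>!g. g \<in> Arr E \<and> Cod E g = e \<and> ArrMap p g = f"
  using discrete_fibration by (auto simp: mem_fibre discrete_fibration_def Src Tgt)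

text \<open>Uniqueness of lifts in the form in which it is used: arrows with a common codomain may
  be compared after projecting to \<open>B\<close>.\<close>

lemma arr_eqI:
  assumes "f \<in> Arr E" "g \<in> Arr E" "Cod E f = Cod E g" "ArrMap p f = ArrMap p g"
  shows "f = g"
proof -
  have "Cod E f \<in> fibre p (ObjMap p (Cod E f))"
    using assms by (simp add: mem_fibre)
  from lift_ex1[OF this ArrMap_p(1)[OF assms(1)] ArrMap_p(3)[OF assms(1)]] show ?thesis
    using assms by metis
qed

lemma lift:
  assumes "e \<in> fibre p b" "f \<in> Arr B" "Cod B f = b"
  shows "lift p e f \<in> Arr E" "Cod E (lift p e f) = e" "ArrMap p (lift p e f) = f"
  using theI'[OF lift_ex1[OF assms]] by (auto simp: lift_def Src)

lemma lift_unique: "g \<in> Arr E \<Longrightarrow> lift p (Cod E g) (ArrMap p g) = g"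
  using lift[of "Cod E g" "ObjMap p (Cod E g)" "ArrMap p g"] ArrMap_p
  by (intro arr_eqI) (auto simp: mem_fibre)

text \<open>Every arrow is the lift of its own image, so exhibiting any arrow over f with codomain e
  computes \<open>pull p f e\<close> as its domain.\<close>

lemma pull_arr: "g \<in> Arr E \<Longrightarrow> pull p (ArrMap p g) (Cod E g) = Dom E g"
  by (simp add: pull_def Src lift_unique)

lemma pull_fibre:
  "e \<in> fibre p b \<Longrightarrow> f \<in> Arr B \<Longrightarrow> Cod B f = b \<Longrightarrow> pull p f e \<in> fibre p (Dom B f)"
  using lift[of e b f] ArrMap_p[of "lift p e f"] by (auto simp: mem_fibre pull_def Src)

lemma pull_Id: "e \<in> fibre p b \<Longrightarrow> pull p (Id B b) e = e"
  using pull_arr[of "Id E e"] F.ArrMap_Id[of e]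
  by (auto simp: mem_fibre Src Tgt E.Dom_Id E.Cod_Id)

text \<open>The lift of f at e composed with the lift of g at f^* e lies over
  \<open>Comp B f g\<close> and has codomain e. By uniqueness it is the lift of the composite, and
  its domain is g^* (f^* e).\<close>

lemma pull_Comp:
  assumes e: "e \<in> fibre p b" and f: "f \<in> Arr B" "Cod B f = b" and g: "g \<in> Arr B" "Cod B g = Dom B f"
  shows "pull p (Comp B f g) e = pull p g (pull p f e)"
proof -
  note l = lift[OF e f]
  note m = lift[OF pull_fibre[OF e f] g]
  have c: "composable E (lift p e f) (lift p (pull p f e) g)"
    using l m by (simp add: composable_def pull_def Src)
  have "ArrMap p (Comp E (lift p e f) (lift p (pull p f e) g)) = Comp B f g"
    using F.ArrMap_Comp[unfolded Src Tgt, OF c] l m by simp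
  with pull_arr[OF E.Comp_closed[OF c]] E.Dom_Comp[OF c] E.Cod_Comp[OF c] l m show ?thesis
    by (simp add: pull_def Src)
qed

end

section \<open>Objects, arrows and composition of \<open>DFib small B\<close>\<close>

lemma mem_Obj_DFib:
  "p \<in> Obj (DFib small B) \<longleftrightarrow>
    discrete_fibration p \<and> Tgt p = B \<and> small_category small (Src p) \<and> small_category small B"
  by (auto simp: DFib_def full_subcategory_def slice_def Cat_def discrete_fibration_def)

lemma dfib_Obj_DFib: "p \<in> Obj (DFib small B) \<Longrightarrow> dfib p (Src p) B"
  by (simp add: mem_Obj_DFib dfib_def)

lemma hom_full_subcategory:
  "f \<in> hom (full_subcategory C S) x y \<longleftrightarrow> f \<in> hom C x y \<and> x \<in> S \<and> y \<in> S"
  by (auto simp: hom_def full_subcategory_def)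

lemma Comp_full_subcategory:
  "g \<in> hom (full_subcategory C S) y z \<Longrightarrow> f \<in> hom (full_subcategory C S) x y \<Longrightarrow>
    Comp (full_subcategory C S) g f = Comp C g f"
  unfolding hom_full_subcategory by (auto simp: hom_def full_subcategory_def)

lemma hom_slice:
  "u \<in> hom (slice C b) p q \<longleftrightarrow> (\<exists>h. u = (p, h, q) \<and> p \<in> Arr C \<and> Cod C p = b \<and> q \<in> Arr C \<and>
    Cod C q = b \<and> h \<in> hom C (Dom C p) (Dom C q) \<and> Comp C q h = p)"
  unfolding hom_def[of "slice C b"] by (cases u) (auto simp: slice_def)

lemma Comp_slice:
  "(q, k, r) \<in> hom (slice C b) q r \<Longrightarrow> (p, h, q) \<in> hom (slice C b) p q \<Longrightarrow>
    Comp (slice C b) (q, k, r) (p, h, q) = (p, Comp C k h, r)"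
  unfolding hom_slice by (auto simp: slice_def)

lemma hom_Cat:
  "F \<in> hom (Cat small) C D \<longleftrightarrow>
    F \<in> functors C D \<and> small_category small C \<and> small_category small D"
  by (auto simp: hom_def Cat_def functors_def)

lemma Comp_Cat:
  "G \<in> hom (Cat small) D E \<Longrightarrow> F \<in> hom (Cat small) C D \<Longrightarrow> Comp (Cat small) G F = comp_functor G F"
  unfolding hom_Cat by (auto simp: Cat_def functors_def)

lemma Cat_arrow_iff:
  "p \<in> Arr (Cat small) \<and> Cod (Cat small) p = B \<longleftrightarrow> p \<in> hom (Cat small) (Src p) B"
  "p \<in> hom (Cat small) (Src p) B \<Longrightarrow> Dom (Cat small) p = Src p"
  by (auto simp: hom_def Cat_def)

lemma DFib_Cat_arrow: "p \<in> Obj (DFib small B) \<Longrightarrow> p \<in> hom (Cat small) (Src p) B"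
  by (auto simp: mem_Obj_DFib hom_Cat functors_def discrete_fibration_def)

text \<open>Unwinds \<open>full_subcategory\<close>, \<open>slice\<close> and \<open>Cat\<close> in
  one place, so that from here on an arrow is just a functor over \<open>B\<close>.\<close>

lemma hom_DFib:
  "u \<in> hom (DFib small B) p q \<longleftrightarrow> (\<exists>h. u = (p, h, q) \<and> p \<in> Obj (DFib small B) \<and>
    q \<in> Obj (DFib small B) \<and> h \<in> functors (Src p) (Src q) \<and> comp_functor q h = p)"
  (is "?L \<longleftrightarrow> ?R")
proof
  assume ?L
  then obtain h where u: "u = (p, h, q)" and p: "p \<in> Arr (Cat small) \<and> Cod (Cat small) p = B"
    and q: "q \<in> Arr (Cat small) \<and> Cod (Cat small) q = B"
    and h: "h \<in> hom (Cat small) (Dom (Cat small) p) (Dom (Cat small) q)" "Comp (Cat small) q h = p"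
    and df: "discrete_fibration p" "discrete_fibration q"
    by (auto simp: DFib_def hom_full_subcategory hom_slice)
  note p' = p[unfolded Cat_arrow_iff(1)] and q' = q[unfolded Cat_arrow_iff(1)]
  have h': "h \<in> hom (Cat small) (Src p) (Src q)"
    using h(1) p' q' by (simp add: Cat_arrow_iff(2))
  show ?R
    using u p' q' df h' h(2) Comp_Cat[OF q' h'] by (auto simp: mem_Obj_DFib hom_Cat functors_def)
next
  assume ?R
  then obtain h where u: "u = (p, h, q)" and p: "p \<in> Obj (DFib small B)"
    and q: "q \<in> Obj (DFib small B)" and h: "h \<in> functors (Src p) (Src q)" "comp_functor q h = p"
    by blast
  have p': "p \<in> hom (Cat small) (Src p) B" and q': "q \<in> hom (Cat small) (Src q) B"
    using p q by (auto intro: DFib_Cat_arrow)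
  have h': "h \<in> hom (Cat small) (Src p) (Src q)"
    using h p q by (simp add: hom_Cat mem_Obj_DFib)
  show ?L
    using u p' q' h' h(2) Comp_Cat[OF q' h'] Cat_arrow_iff[of p small B] Cat_arrow_iff[of q small B] p q
    by (simp add: DFib_def hom_full_subcategory hom_slice) (simp add: mem_Obj_DFib flip: DFib_def)
qed

lemma Id_DFib:
  assumes "p \<in> Obj (DFib small B)"
  shows "Id (DFib small B) p = (p, id_functor (Src p), p)"
  using DFib_Cat_arrow[OF assms] assms
  by (auto simp: mem_Obj_DFib DFib_def full_subcategory_def slice_def hom_Cat Cat_def functors_def)

lemma Comp_DFib:
  assumes "(q, k, r) \<in> hom (DFib small B) q r" "(p, h, q) \<in> hom (DFib small B) p q"
  shows "Comp (DFib small B) (q, k, r) (p, h, q) = (p, comp_functor k h, r)"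
proof -
  have "k \<in> hom (Cat small) (Src q) (Src r)" "h \<in> hom (Cat small) (Src p) (Src q)"
    using assms by (auto simp: hom_DFib mem_Obj_DFib hom_Cat)
  from Comp_Cat[OF this] show ?thesis
    using assms Comp_full_subcategory[OF assms[unfolded DFib_def]] unfolding DFib_def hom_full_subcategory
    by (simp add: Comp_slice)
qed

lemma category_DFib: "category (DFib small B)"
  unfolding DFib_def
  by (intro category.category_full_subcategory category.category_slice category_Cat)


section \<open>The presheaf of fibres\<close>

definition fibre_presheaf ::
  "('u set \<Rightarrow> bool) \<Rightarrow> ('u, 'a, 'p, 'b) ftor \<Rightarrow> ('p, 'b, 'u set, 'u set \<times> ('u \<Rightarrow> 'u) \<times> 'u set) ftor"
  where "fibre_presheaf small p = \<lparr>Src = opposite (Tgt p), Tgt = Set_cat small,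
    ObjMap = restrict (fibre p) (Obj (opposite (Tgt p))),
    ArrMap = restrict (\<lambda>f. (fibre p (Cod (Tgt p) f),
      restrict (pull p f) (fibre p (Cod (Tgt p) f)), fibre p (Dom (Tgt p) f)))
      (Arr (opposite (Tgt p)))\<rparr>"

lemma (in dfib) fibre_presheaf_simps [simp]:
  "b \<in> Obj B \<Longrightarrow> ObjMap (fibre_presheaf small p) b = fibre p b"
  "f \<in> Arr B \<Longrightarrow> ArrMap (fibre_presheaf small p) f =
    (fibre p (Cod B f), restrict (pull p f) (fibre p (Cod B f)), fibre p (Dom B f))"
  by (simp_all add: fibre_presheaf_def Tgt)

text \<open>The functor laws are \<open>pull_Id\<close> and \<open>pull_Comp\<close>. Smallness of
  the fibres is a hypothesis because the locale \<open>dfib\<close> does not mention the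
  universe.\<close>

lemma (in dfib) fibre_presheaf:
  assumes small: "\<And>b. b \<in> Obj B \<Longrightarrow> small (fibre p b)"
  shows "fibre_presheaf small p \<in> functors (opposite B) (Set_cat small)"
  unfolding fibre_presheaf_def Tgt
proof (rule functorI[OF B.category_opposite category_Set_cat], goal_cases)
  case (2 x y f)
  then show ?case
    using pull_fibre[of _ "Cod B f" f] by (auto simp: hom_Set_cat hom_def small)
next
  case (3 b)
  then show ?case
    by (auto simp: B.Dom_Id B.Cod_Id small pull_Id intro!: restrict_ext)
next
  case (4 x y z f g)
  then have fg: "f \<in> Arr B" "g \<in> Arr B" "Cod B g = Dom B f"
    by (auto simp: hom_def)
  \<comment> \<open>The composite of g after f in \<open>opposite B\<close> is
    \<open>Comp B f g\<close>, so f acts first on fibres.\<close>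
  have "restrict (pull p (Comp B f g)) (fibre p (Cod B f)) =
      compose (fibre p (Cod B f)) (restrict (pull p g) (fibre p (Cod B g)))
        (restrict (pull p f) (fibre p (Cod B f)))"
    using pull_Comp[of _ "Cod B f" f g] pull_fibre[of _ "Cod B f" f] fg
    by (auto simp: compose_def intro!: restrict_ext)
  then show ?case
    using fg pull_fibre[of _ "Cod B f" f] pull_fibre[of _ "Cod B g" g]
    by (auto simp: small B.Comp_Arr)
qed (simp add: small)

text \<open>Only \<open>ObjMap h\<close> is recorded; \<open>ArrMap_determined\<close> below shows
  that \<open>ArrMap h\<close> can be recovered from it.\<close>

definition fibre_map ::
  "('u set \<Rightarrow> bool) \<Rightarrow> ('u, 'a, 'p, 'b) ftor \<times> ('u, 'a, 'u, 'a) ftor \<times> ('u, 'a, 'p, 'b) ftor \<Rightarrow>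
    ('p, 'b, 'u set, 'u set \<times> ('u \<Rightarrow> 'u) \<times> 'u set) ntrans"
  where "fibre_map small = (\<lambda>(p, h, q). \<lparr>NDom = fibre_presheaf small p, NCod = fibre_presheaf small q,
    At = restrict (\<lambda>b. (fibre p b, restrict (ObjMap h) (fibre p b), fibre q b))
      (Obj (opposite (Tgt p)))\<rparr>)"

lemma small_fibre:
  assumes "small_universe small" "p \<in> Obj (DFib small B)"
  shows "small (fibre p b)"
  using small_universe.small_subset[OF assms(1), of "Obj (Src p)"] assms(2)
  by (auto simp: fibre_def small_category_def mem_Obj_DFib)

lemma fibre_presheaf_DFib:
  assumes "small_universe small" "p \<in> Obj (DFib small B)"
  shows "fibre_presheaf small p \<in> functors (opposite B) (Set_cat small)"
  by (intro dfib.fibre_presheaf[OF dfib_Obj_DFib[OF assms(2)]] small_fibre[OF assms])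

lemma Obj_functor_category [simp]: "Obj (functor_category C D) = functors C D"
  by (simp add: functor_category_def)

lemma hom_functor_category:
  "\<alpha> \<in> hom (functor_category C D) F G \<longleftrightarrow> is_ntrans C D \<alpha> \<and> NDom \<alpha> = F \<and> NCod \<alpha> = G"
  by (auto simp: hom_def functor_category_def)

lemma Comp_functor_category:
  assumes "\<beta> \<in> hom (functor_category C D) G H" "\<alpha> \<in> hom (functor_category C D) F G"
  shows "Comp (functor_category C D) \<beta> \<alpha> = \<lparr>NDom = F, NCod = H,
    At = restrict (\<lambda>x. Comp D (At \<beta> x) (At \<alpha> x)) (Obj C)\<rparr>"
  using assms unfolding hom_functor_category by (auto simp: functor_category_def)

section \<open>Functors over \<open>B\<close> between two discrete fibrations\<close>

locale dfib_over =
  fixes p q h :: "('u, 'u, 'u, 'u) ftor" and E E' B :: "('u, 'u) cat"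
  assumes p: "dfib p E B" and q: "dfib q E' B" and h: "h \<in> functors E E'"
    and over: "comp_functor q h = p"
begin

sublocale p: dfib p E B by (rule p)
sublocale q: dfib q E' B by (rule q)

lemma ObjMap_over: "e \<in> Obj E \<Longrightarrow> ObjMap q (ObjMap h e) = ObjMap p e"
  using over h by (auto simp: functors_def)

lemma ArrMap_over: "f \<in> Arr E \<Longrightarrow> ArrMap q (ArrMap h f) = ArrMap p f"
  using over h by (auto simp: functors_def)

lemma ObjMap_fibre: "e \<in> fibre p b \<Longrightarrow> ObjMap h e \<in> fibre q b"
  by (simp add: p.mem_fibre q.mem_fibre ObjMap_over functor_Obj[OF h])

lemma ArrMap_h: "f \<in> Arr E \<Longrightarrow> ArrMap h f \<in> hom E' (ObjMap h (Dom E f)) (ObjMap h (Cod E f))"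
  by (rule functor_hom[OF h homI]) simp_all

text \<open>\<open>ArrMap h f\<close> lies over \<open>ArrMap p f\<close> and its codomain is
  \<open>ObjMap h (Cod E f)\<close>, which leaves only one arrow. Faithfulness rests on
  this.\<close>

lemma ArrMap_determined: "f \<in> Arr E \<Longrightarrow> ArrMap h f = lift q (ObjMap h (Cod E f)) (ArrMap p f)"
  using q.lift_unique[of "ArrMap h f"] ArrMap_h[of f] by (auto simp: hom_def ArrMap_over)

text \<open>The functor h carries the lift of f at e to the lift of f at h(e); comparing domains
  gives the naturality of the maps of fibres.\<close>

lemma pull_over:
  assumes e: "e \<in> fibre p b" and f: "f \<in> Arr B" "Cod B f = b"
  shows "pull q f (ObjMap h e) = ObjMap h (pull p f e)"
  using p.lift[OF e f] ArrMap_determined[of "lift p e f"] ArrMap_h[of "lift p e f"]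
  by (simp add: pull_def p.Src q.Src hom_def)

lemma fibre_map_ntrans:
  assumes "small_universe small" "p \<in> Obj (DFib small B)" "q \<in> Obj (DFib small B)"
  shows "is_ntrans (opposite B) (Set_cat small) (fibre_map small (p, h, q))"
  unfolding fibre_map_def prod.case p.Tgt
proof (rule ntransI)
  fix x y f assume "f \<in> hom (opposite B) x y"
  then have f: "f \<in> Arr B" "Cod B f = x" "Dom B f = y" "x \<in> Obj B" "y \<in> Obj B"
    by (auto simp: hom_def)
  have "compose (fibre p x) (restrict (pull q f) (fibre q x)) (restrict (ObjMap h) (fibre p x)) =
    compose (fibre p x) (restrict (ObjMap h) (fibre p y)) (restrict (pull p f) (fibre p x))"
    using pull_over[of _ x f] f ObjMap_fibre p.pull_fibre[of _ x f]
    by (auto simp: compose_def intro!: restrict_ext)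
  moreover have "restrict (pull p f) (fibre p x) \<in> fibre p x \<rightarrow>\<^sub>E fibre p y"
    "restrict (pull q f) (fibre q x) \<in> fibre q x \<rightarrow>\<^sub>E fibre q y"
    "restrict (ObjMap h) (fibre p x) \<in> fibre p x \<rightarrow>\<^sub>E fibre q x"
    "restrict (ObjMap h) (fibre p y) \<in> fibre p y \<rightarrow>\<^sub>E fibre q y"
    using f ObjMap_fibre p.pull_fibre[of _ x f] q.pull_fibre[of _ x f] by auto
  ultimately show "Comp (Set_cat small) (ArrMap (fibre_presheaf small q) f)
      (fibre p x, restrict (ObjMap h) (fibre p x), fibre q x) =
    Comp (Set_cat small) (fibre p y, restrict (ObjMap h) (fibre p y), fibre q y)
      (ArrMap (fibre_presheaf small p) f)"
    using f by (simp add: small_fibre[OF assms(1,2)] small_fibre[OF assms(1,3)])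
qed (use assms ObjMap_fibre in \<open>auto simp: fibre_presheaf_DFib hom_Set_cat small_fibre\<close>)

lemma At_fibre_map:
  "b \<in> Obj B \<Longrightarrow>
    At (fibre_map small (p, h, q)) b = (fibre p b, restrict (ObjMap h) (fibre p b), fibre q b)"
  by (simp add: fibre_map_def p.Tgt)

end

lemma fibre_map_simps [simp]:
  "NDom (fibre_map small (p, h, q)) = fibre_presheaf small p"
  "NCod (fibre_map small (p, h, q)) = fibre_presheaf small q"
  by (simp_all add: fibre_map_def)

lemma dfib_over_hom:
  "(p, h, q) \<in> hom (DFib small B) p q \<Longrightarrow> dfib_over p q h (Src p) (Src q) B"
  by (auto simp: hom_DFib dfib_over_def intro: dfib_Obj_DFib)

lemma fibre_map_hom:
  assumes "small_universe small" "u \<in> hom (DFib small B) p q"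
  shows "fibre_map small u \<in> hom (functor_category (opposite B) (Set_cat small))
    (fibre_presheaf small p) (fibre_presheaf small q)"
proof -
  obtain h where u: "u = (p, h, q)" and pq: "p \<in> Obj (DFib small B)" "q \<in> Obj (DFib small B)"
    using assms(2) by (auto simp: hom_DFib)
  show ?thesis
    using dfib_over.fibre_map_ntrans[OF dfib_over_hom assms(1) pq] assms(2)
    by (simp add: u hom_functor_category)
qed

section \<open>The functor from fibrations to presheaves and its full faithfulness\<close>

definition fibre_functor where
  "fibre_functor small B = \<lparr>Src = DFib small B, Tgt = functor_category (opposite B) (Set_cat small),
    ObjMap = restrict (fibre_presheaf small) (Obj (DFib small B)),
    ArrMap = restrict (fibre_map small) (Arr (DFib small B))\<rparr>"

lemma fibre_functor:
  assumes "small_universe small"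
  shows "fibre_functor small B \<in> functors (DFib small B) (functor_category (opposite B) (Set_cat small))"
  unfolding fibre_functor_def
proof (rule functorI[OF category_DFib category_functor_category], goal_cases)
  case (3 p)
  interpret dfib p "Src p" B by (rule dfib_Obj_DFib[OF 3])
  have "restrict (ObjMap (id_functor (Src p))) (fibre p b) = restrict (\<lambda>x. x) (fibre p b)" for b
    by (auto simp: mem_fibre intro!: restrict_ext)
  then show ?case
    using 3 by (simp add: Id_DFib functor_category_def fibre_presheaf_DFib assms)
      (auto simp: fibre_map_def Tgt small_fibre[OF assms 3] intro!: restrict_ext)
next
  case (4 p q r u v)
  then obtain h k where u: "u = (p, h, q)" and v: "v = (q, k, r)"
    by (auto simp: hom_DFib)
  interpret h: dfib_over p q h "Src p" "Src q" B
    using 4(2) u dfib_over_hom by auto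
  interpret k: dfib_over q r k "Src q" "Src r" B
    using 4(1) v dfib_over_hom by auto
  have pqr: "p \<in> Obj (DFib small B)" "q \<in> Obj (DFib small B)" "r \<in> Obj (DFib small B)"
    using 4 by (auto simp: hom_DFib)
  have "restrict (ObjMap (comp_functor k h)) (fibre p b) =
      compose (fibre p b) (restrict (ObjMap k) (fibre q b)) (restrict (ObjMap h) (fibre p b))" for b
    using h.ObjMap_fibre h.h
    by (auto simp: compose_def h.p.mem_fibre functors_def intro!: restrict_ext)
  then have "(fibre p b, restrict (ObjMap (comp_functor k h)) (fibre p b), fibre r b) =
      Comp (Set_cat small) (At (fibre_map small v) b) (At (fibre_map small u) b)" if "b \<in> Obj B" for b
    using h.ObjMap_fibre[of _ b] k.ObjMap_fibre[of _ b] pqr that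
    by (auto simp: u v h.At_fibre_map k.At_fibre_map small_fibre[OF assms])
  then show ?case
    using 4 Comp_functor_category[OF fibre_map_hom[OF assms 4(1)] fibre_map_hom[OF assms 4(2)]]
    by (simp add: u v Comp_DFib) (simp add: fibre_map_def h.p.Tgt cong: restrict_cong)
qed (simp_all add: fibre_presheaf_DFib assms fibre_map_hom)

lemma fibre_functor_simps [simp]:
  "p \<in> Obj (DFib small B) \<Longrightarrow> ObjMap (fibre_functor small B) p = fibre_presheaf small p"
  "u \<in> hom (DFib small B) p q \<Longrightarrow> ArrMap (fibre_functor small B) u = fibre_map small u"
  by (auto simp: fibre_functor_def hom_def)

text \<open>Each object e lies in the fibre over p(e), so the components fix \<open>ObjMap h\<close>
  everywhere, and \<open>ArrMap_determined\<close> then fixes \<open>ArrMap h\<close>.\<close>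

lemma inj_on_fibre_map: "inj_on (fibre_map small) (hom (DFib small B) p q)"
proof (rule inj_onI)
  fix u v assume u: "u \<in> hom (DFib small B) p q" and v: "v \<in> hom (DFib small B) p q"
    and eq: "fibre_map small u = fibre_map small v"
  obtain h k where uh: "u = (p, h, q)" and vk: "v = (p, k, q)"
    using u v by (auto simp: hom_DFib)
  interpret h: dfib_over p q h "Src p" "Src q" B
    using u uh dfib_over_hom by auto
  interpret k: dfib_over p q k "Src p" "Src q" B
    using v vk dfib_over_hom by auto
  have "ObjMap h e = ObjMap k e" if e: "e \<in> Obj (Src p)" for e
  proof -
    have b: "ObjMap p e \<in> Obj B"
      using functor_Obj[OF h.p.p e] .
    have "restrict (ObjMap h) (fibre p (ObjMap p e)) = restrict (ObjMap k) (fibre p (ObjMap p e))"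
      using h.At_fibre_map[OF b, of small] k.At_fibre_map[OF b, of small] eq uh vk by simp
    from fun_cong[OF this, of e] e show ?thesis
      by (simp add: h.p.mem_fibre)
  qed
  then have "h = k"
    using h.h k.h by (intro functor_eqI) (auto simp: h.ArrMap_determined k.ArrMap_determined)
  then show "u = v"
    by (simp add: uh vk)
qed

text \<open>The components of \<alpha> glue to a map on objects, and an arrow g must go to the lift
  of p(g) at the image of its codomain. The essential point is that this lift has the right domain,
  which is naturality of \<alpha> at p(g).\<close>

lemma fibre_map_surj:
  assumes U: "small_universe small" and p: "p \<in> Obj (DFib small B)" and q: "q \<in> Obj (DFib small B)"
    and \<alpha>: "\<alpha> \<in> hom (functor_category (opposite B) (Set_cat small))
      (fibre_presheaf small p) (fibre_presheaf small q)"
  shows "\<exists>u \<in> hom (DFib small B) p q. fibre_map small u = \<alpha>"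
proof -
  interpret p: dfib p "Src p" B by (rule dfib_Obj_DFib[OF p])
  interpret q: dfib q "Src q" B by (rule dfib_Obj_DFib[OF q])
  interpret \<alpha>: is_ntrans "opposite B" "Set_cat small" \<alpha>
    using \<alpha> by (simp add: hom_functor_category)
  have \<alpha>_dom: "NDom \<alpha> = fibre_presheaf small p" "NCod \<alpha> = fibre_presheaf small q"
    using \<alpha> by (auto simp: hom_functor_category)
  define a where "a b = fst (snd (At \<alpha> b))" for b
  have At: "At \<alpha> b = (fibre p b, a b, fibre q b)" and a: "a b \<in> fibre p b \<rightarrow>\<^sub>E fibre q b"
    if "b \<in> Obj B" for b
    using \<alpha>.At_closed[of b] that by (auto simp: \<alpha>_dom hom_Set_cat a_def)
  note sp = small_fibre[OF U p] and sq = small_fibre[OF U q]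
  \<comment> \<open>Naturality of \<alpha> at f is an equation between arrows of
    \<open>Set_cat\<close>; here it is evaluated at the element e.\<close>
  have a_pull: "a (Dom B f) (pull p f e) = pull q f (a b e)"
    if f: "f \<in> Arr B" "Cod B f = b" and e: "e \<in> fibre p b" for f b e
  proof -
    have b: "b \<in> Obj B" "Dom B f \<in> Obj B" using f by auto
    have "compose (fibre p b) (restrict (pull q f) (fibre q b)) (a b) =
        compose (fibre p b) (a (Dom B f)) (restrict (pull p f) (fibre p b))"
      using \<alpha>.naturality[of f] f b a[OF b(1)] a[OF b(2)]
        p.pull_fibre[of _ b f] q.pull_fibre[of _ b f]
      by (auto simp: \<alpha>_dom At sp sq)
    from fun_cong[OF this, of e] show ?thesis
      using e PiE_mem[OF a[OF b(1)] e] by (simp add: compose_def)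
  qed
  define ho where "ho e = a (ObjMap p e) e" for e
  define ha where "ha g = lift q (ho (Cod (Src p) g)) (ArrMap p g)" for g
  have ho: "ho e \<in> fibre q (ObjMap p e)" if "e \<in> Obj (Src p)" for e
    using a[OF functor_Obj[OF p.p that]] that by (auto simp: ho_def p.mem_fibre)
  have ha: "ha g \<in> hom (Src q) (ho x) (ho y)" "ArrMap q (ha g) = ArrMap p g"
    if g: "g \<in> hom (Src p) x y" for g x y
  proof -
    have gA: "g \<in> Arr (Src p)" "Dom (Src p) g = x" "Cod (Src p) g = y"
      and xy: "x \<in> Obj (Src p)" "y \<in> Obj (Src p)"
      using g by (auto simp: hom_def)
    note pg = p.ArrMap_p[OF gA(1)]
    note l = q.lift[OF ho[OF xy(2)] pg(1)]
    \<comment> \<open>The domain of the lift is (p g)^* applied to the image of y. By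
      \<open>a_pull\<close> this is the image of (p g)^* y, and (p g)^* y = x because g itself is
      the lift of p(g) at y.\<close>
    have "Dom (Src q) (ha g) = pull q (ArrMap p g) (ho y)"
      by (simp add: ha_def pull_def gA)
    also have "\<dots> = a (ObjMap p x) (pull p (ArrMap p g) y)"
      using a_pull[OF pg(1,3), of y] gA xy by (simp add: ho_def p.mem_fibre pg)
    also have "\<dots> = ho x"
      using p.pull_arr[OF gA(1)] gA by (simp add: ho_def)
    finally show "ha g \<in> hom (Src q) (ho x) (ho y)"
      using l pg gA by (simp add: hom_def ha_def)
    show "ArrMap q (ha g) = ArrMap p g"
      using l pg gA by (simp add: ha_def)
  qed
  define h where "h = \<lparr>Src = Src p, Tgt = Src q, ObjMap = restrict ho (Obj (Src p)),
    ArrMap = restrict ha (Arr (Src p))\<rparr>"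
  have h: "h \<in> functors (Src p) (Src q)"
    unfolding h_def
  proof (rule functorI)
    fix x assume x: "x \<in> Obj (Src p)"
    have hox: "ho x \<in> Obj (Src q)" "ObjMap q (ho x) = ObjMap p x"
      using ho[OF x] by (simp_all add: q.mem_fibre)
    note i = ha[OF p.E.Id_hom[OF x]] q.E.Id_hom[OF hox(1)]
    \<comment> \<open>Both sides end at \<open>ho x\<close> and lie over the identity of p(x), so
      uniqueness of lifts identifies them. Composites are treated likewise.\<close>
    show "ha (Id (Src p) x) = Id (Src q) (ho x)"
      by (rule q.arr_eqI)
        (use x hox i(2) homD[OF i(1)] homD[OF i(3)] in \<open>simp_all add: functor_Id[OF p.p] functor_Id[OF q.p]\<close>)
  next
    fix x y z f g assume g: "g \<in> hom (Src p) y z" and f: "f \<in> hom (Src p) x y"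
    note gf = p.E.Comp_hom[OF g f]
    have ArrMap_eq: "ArrMap q (ha (Comp (Src p) g f)) = ArrMap q (Comp (Src q) (ha g) (ha f))"
      using ha[OF g] ha[OF f] ha(2)[OF gf]
      by (simp add: functor_Comp[OF p.p g f] functor_Comp[OF q.p ha(1)[OF g] ha(1)[OF f]])
    show "ha (Comp (Src p) g f) = Comp (Src q) (ha g) (ha f)"
      by (rule q.arr_eqI[OF _ _ _ ArrMap_eq])
        (use homD[OF ha(1)[OF gf]] homD[OF q.E.Comp_hom[OF ha(1)[OF g] ha(1)[OF f]]] in simp_all)
  qed (use ho ha in \<open>auto simp: q.mem_fibre p.E.category_axioms q.E.category_axioms\<close>)
  have over: "comp_functor q h = p"
  proof (rule functor_eqI[OF comp_functor_functors[OF h q.p] p.p])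
    show "ObjMap (comp_functor q h) x = ObjMap p x" if "x \<in> Obj (Src p)" for x
      using that ho[OF that] by (simp add: h_def q.mem_fibre)
    show "ArrMap (comp_functor q h) f = ArrMap p f" if "f \<in> Arr (Src p)" for f
      using that ha(2)[OF homI[OF that refl refl]] by (simp add: h_def)
  qed
  interpret h: dfib_over p q h "Src p" "Src q" B
    by unfold_locales (use h over in auto)
  have u: "(p, h, q) \<in> hom (DFib small B) p q"
    using p q h over by (simp add: hom_DFib)
  have "fibre_map small (p, h, q) = \<alpha>"
  proof (rule ntrans_eqI[OF h.fibre_map_ntrans[OF U p q] \<alpha>.is_ntrans_axioms])
    fix b assume "b \<in> Obj (opposite B)"
    then have b: "b \<in> Obj B" by simp
    have "restrict (ObjMap h) (fibre p b) = a b"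
      using a[OF b] by (auto simp: fun_eq_iff h_def ho_def p.mem_fibre PiE_iff extensional_def)
    then show "At (fibre_map small (p, h, q)) b = At \<alpha> b"
      using b by (simp add: h.At_fibre_map At)
  qed (simp_all add: \<alpha>_dom)
  with u show ?thesis by blast
qed


section \<open>The category of elements\<close>

text \<open>The universe only asserts that an injective pairing exists; fixing one as a parameter
  allows the category of elements to be a definition.\<close>

locale presheaf = B: category B + small_universe small
  for B :: "('u, 'u) cat" and small :: "'u set \<Rightarrow> bool" +
  fixes P :: "('u, 'u, 'u set, 'u set \<times> ('u \<Rightarrow> 'u) \<times> 'u set) ftor" and pair :: "'u \<times> 'u \<Rightarrow> 'u"
  assumes small_B: "small_category small B"
    and P: "P \<in> functors (opposite B) (Set_cat small)"
    and inj: "inj pair"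
begin

definition act :: "'u \<Rightarrow> 'u \<Rightarrow> 'u" where
  "act f = fst (snd (ArrMap P f))"

lemma small_P: "b \<in> Obj B \<Longrightarrow> small (ObjMap P b)"
  using functor_Obj[OF P, of b] by simp

lemma ArrMap_P:
  assumes "f \<in> Arr B"
  shows "ArrMap P f = (ObjMap P (Cod B f), act f, ObjMap P (Dom B f))"
    and "act f \<in> ObjMap P (Cod B f) \<rightarrow>\<^sub>E ObjMap P (Dom B f)"
  using functor_hom[OF P, of f "Cod B f" "Dom B f"] assms by (auto simp: hom_Set_cat hom_def[of "opposite B"] act_def)

lemma act_closed: "f \<in> Arr B \<Longrightarrow> x \<in> ObjMap P (Cod B f) \<Longrightarrow> act f x \<in> ObjMap P (Dom B f)"
  using ArrMap_P(2) by auto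

lemma act_Id: "b \<in> Obj B \<Longrightarrow> x \<in> ObjMap P b \<Longrightarrow> act (Id B b) x = x"
  using functor_Id[OF P, of b] by (simp add: act_def small_P)

lemma act_Comp:
  assumes f: "f \<in> Arr B" and g: "g \<in> Arr B" "Dom B g = Cod B f" and x: "x \<in> ObjMap P (Cod B g)"
  shows "act (Comp B g f) x = act f (act g x)"
proof -
  have "ArrMap P (Comp B g f) = Comp (Set_cat small) (ArrMap P f) (ArrMap P g)"
    using functor_Comp[OF P, of f "Cod B f" "Dom B f" g "Cod B g"] f g by (simp add: hom_def)
  also have "\<dots> = (ObjMap P (Cod B g), compose (ObjMap P (Cod B g)) (act f) (act g), ObjMap P (Dom B f))"
    using ArrMap_P[OF f] ArrMap_P[OF g(1)] f g by (simp add: small_P)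
  finally show ?thesis
    using x by (simp add: act_def compose_def)
qed

definition unpair :: "'u \<Rightarrow> 'u \<times> 'u" where
  "unpair = inv pair"

lemma unpair [simp]: "unpair (pair z) = z"
  using inj by (simp add: unpair_def)

lemma pair_eq [simp]: "pair y = pair z \<longleftrightarrow> y = z"
  using inj by (simp add: inj_eq)

text \<open>An arrow \<open>(f, x)\<close> of the category of elements is the unique lift of \<open>f\<close> with codomain
  \<open>(Cod B f, x)\<close>; its domain is determined by the action of \<open>f\<close>.\<close>

definition elements :: "('u, 'u) cat" where
  "elements = make_cat (pair ` (SIGMA b : Obj B. ObjMap P b))
    (pair ` (SIGMA f : Arr B. ObjMap P (Cod B f)))
    (\<lambda>u. case unpair u of (f, x) \<Rightarrow> pair (Dom B f, act f x))
    (\<lambda>u. case unpair u of (f, x) \<Rightarrow> pair (Cod B f, x))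
    (\<lambda>u. case unpair u of (b, x) \<Rightarrow> pair (Id B b, x))
    (\<lambda>v u. pair (Comp B (fst (unpair v)) (fst (unpair u)), snd (unpair v)))"

text \<open>In a composite of (g, y) after (f, x) the element x equals \<open>act g y\<close>, so
  keeping y loses nothing. The laws for domains of identities and composites are
  \<open>act_Id\<close> and \<open>act_Comp\<close>.\<close>

lemma category_elements: "category elements"
  unfolding elements_def
  by (rule category_make_cat)
    (use B.Comp_assoc in \<open>auto simp: act_closed B.Dom_Id B.Cod_Id act_Id B.Comp_Arr act_Comp
      B.Comp_Id_left B.Comp_Id_right composable_def\<close>)

lemma elements_simps [simp]:
  "Obj elements = pair ` (SIGMA b : Obj B. ObjMap P b)"
  "Arr elements = pair ` (SIGMA f : Arr B. ObjMap P (Cod B f))"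
  "f \<in> Arr B \<Longrightarrow> x \<in> ObjMap P (Cod B f) \<Longrightarrow> Dom elements (pair (f, x)) = pair (Dom B f, act f x)"
  "f \<in> Arr B \<Longrightarrow> x \<in> ObjMap P (Cod B f) \<Longrightarrow> Cod elements (pair (f, x)) = pair (Cod B f, x)"
  "b \<in> Obj B \<Longrightarrow> x \<in> ObjMap P b \<Longrightarrow> Id elements (pair (b, x)) = pair (Id B b, x)"
  "g \<in> Arr B \<Longrightarrow> y \<in> ObjMap P (Cod B g) \<Longrightarrow> f \<in> Arr B \<Longrightarrow> x \<in> ObjMap P (Cod B f) \<Longrightarrow>
    Dom B g = Cod B f \<Longrightarrow> act g y = x \<Longrightarrow>
    Comp elements (pair (g, y)) (pair (f, x)) = pair (Comp B g f, y)"
  by (auto simp: elements_def image_iff)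

text \<open>Replacement makes each tagged copy of \<open>A i\<close> small, and the union axiom adds
  them up over \<open>I\<close>. Taking \<open>Obj B\<close> and \<open>Arr B\<close> for
  \<open>I\<close> is where smallness of \<open>B\<close> enters.\<close>

lemma small_Sigma:
  assumes "small I" "\<And>i. i \<in> I \<Longrightarrow> small (A i)"
  shows "small (pair ` (SIGMA i : I. A i))"
proof -
  have "pair ` (SIGMA i : I. A i) = (\<Union>i\<in>I. (\<lambda>x. pair (i, x)) ` A i)"
    by auto
  then show ?thesis
    using assms by (auto intro!: small_UN small_image)
qed

lemma small_elements: "small_category small elements"
  using category_elements small_B small_P
  by (auto simp: small_category_def intro!: small_Sigma)

definition projection :: "('u, 'u, 'u, 'u) ftor" where
  "projection = \<lparr>Src = elements, Tgt = B, ObjMap = restrict (\<lambda>u. fst (unpair u)) (Obj elements),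
    ArrMap = restrict (\<lambda>u. fst (unpair u)) (Arr elements)\<rparr>"

lemma projection_functor: "projection \<in> functors elements B"
  unfolding projection_def
  by (rule functorI[OF category_elements B.category_axioms]) (auto simp: hom_def)

lemma projection_simps [simp]:
  "Src projection = elements" "Tgt projection = B"
  "b \<in> Obj B \<Longrightarrow> x \<in> ObjMap P b \<Longrightarrow> ObjMap projection (pair (b, x)) = b"
  "f \<in> Arr B \<Longrightarrow> x \<in> ObjMap P (Cod B f) \<Longrightarrow> ArrMap projection (pair (f, x)) = f"
  by (auto simp: projection_def image_iff)

text \<open>The first coordinate of an arrow is its image in \<open>B\<close> and the second is that
  of its codomain, so image and codomain together determine the arrow.\<close>

lemma discrete_fibration_projection: "discrete_fibration projection"
  unfolding discrete_fibration_def
proof (intro conjI ballI impI)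
  show "is_functor projection"
    using projection_functor by (simp add: functors_def)
  fix e f assume "e \<in> Obj (Src projection)" "f \<in> Arr (Tgt projection)"
    and "Cod (Tgt projection) f = ObjMap projection e"
  then obtain x where e: "e = pair (Cod B f, x)" and x: "x \<in> ObjMap P (Cod B f)" and f: "f \<in> Arr B"
    by auto
  show "\<exists>!g. g \<in> Arr (Src projection) \<and> Cod (Src projection) g = e \<and> ArrMap projection g = f"
    by (rule ex1I[of _ "pair (f, x)"]) (use e x f in auto)
qed

lemma projection_DFib: "projection \<in> Obj (DFib small B)"
  by (simp add: mem_Obj_DFib discrete_fibration_projection small_elements small_B)

sublocale E: dfib projection elements B
  by (rule dfib_Obj_DFib[OF projection_DFib, simplified])

lemma fibre_projection: "b \<in> Obj B \<Longrightarrow> fibre projection b = (\<lambda>x. pair (b, x)) ` ObjMap P b"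
  by (auto simp: E.mem_fibre)

lemma pull_projection:
  "f \<in> Arr B \<Longrightarrow> x \<in> ObjMap P (Cod B f) \<Longrightarrow>
    pull projection f (pair (Cod B f, x)) = pair (Dom B f, act f x)"
  using E.pull_arr[of "pair (f, x)"] by auto

text \<open>The fibre over b consists of the pairs (b, x) with x in \<open>ObjMap P b\<close>, and
  reindexing along f acts on the second coordinate as \<open>act f\<close>. Forgetting the tag is
  therefore bijective and natural.\<close>

lemma fibre_presheaf_projection:
  "isomorphic (functor_category (opposite B) (Set_cat small)) (fibre_presheaf small projection) P"
proof (rule isomorphic_functor_categoryI)
  have U: "small_universe small" ..
  \<comment> \<open>\<open>a b\<close> removes the tag b and \<open>c b\<close> restores it.
    Naturality is checked for \<open>a\<close> alone; for the inverses it follows from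
    \<open>isomorphic_functor_categoryI\<close>.\<close>
  define a where "a b = (fibre projection b, restrict (\<lambda>u. snd (unpair u)) (fibre projection b), ObjMap P b)" for b
  define c where "c b = (ObjMap P b, restrict (\<lambda>x. pair (b, x)) (ObjMap P b), fibre projection b)" for b
  show "is_ntrans (opposite B) (Set_cat small)
    \<lparr>NDom = fibre_presheaf small projection, NCod = P, At = restrict a (Obj (opposite B))\<rparr>"
  proof (rule ntransI[OF fibre_presheaf_DFib[OF U projection_DFib] P])
    show "a b \<in> hom (Set_cat small) (ObjMap (fibre_presheaf small projection) b) (ObjMap P b)"
      if "b \<in> Obj (opposite B)" for b
      using that by (auto simp: a_def hom_Set_cat small_P small_image fibre_projection)
    fix x y f assume "f \<in> hom (opposite B) x y"
    then have f: "f \<in> Arr B" "Cod B f = x" "Dom B f = y" "x \<in> Obj B" "y \<in> Obj B"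
      by (auto simp: hom_def)
    have "compose (fibre projection x) (act f) (restrict (\<lambda>u. snd (unpair u)) (fibre projection x)) =
      compose (fibre projection x) (restrict (\<lambda>u. snd (unpair u)) (fibre projection y))
        (restrict (pull projection f) (fibre projection x))"
      using f pull_projection[of f] act_closed[of f]
      by (auto simp: compose_def fibre_projection intro!: restrict_ext)
    moreover have "restrict (pull projection f) (fibre projection x)
        \<in> fibre projection x \<rightarrow>\<^sub>E fibre projection y"
      using E.pull_fibre[of _ x f] f by auto
    moreover have "restrict (\<lambda>u. snd (unpair u)) (fibre projection b) \<in> fibre projection b \<rightarrow>\<^sub>E ObjMap P b"
      if "b \<in> Obj B" for b
      using that by (auto simp: fibre_projection)
    ultimately show "Comp (Set_cat small) (ArrMap P f) (a x) =
        Comp (Set_cat small) (a y) (ArrMap (fibre_presheaf small projection) f)"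
      using f ArrMap_P[OF f(1)]
      by (simp add: a_def small_P small_fibre[OF U projection_DFib])
  qed
  show "\<exists>g \<in> hom (Set_cat small) (ObjMap P b) (ObjMap (fibre_presheaf small projection) b).
    Comp (Set_cat small) g (At \<lparr>NDom = fibre_presheaf small projection, NCod = P,
      At = restrict a (Obj (opposite B))\<rparr> b) =
      Id (Set_cat small) (ObjMap (fibre_presheaf small projection) b) \<and>
    Comp (Set_cat small) (At \<lparr>NDom = fibre_presheaf small projection, NCod = P,
      At = restrict a (Obj (opposite B))\<rparr> b) g = Id (Set_cat small) (ObjMap P b)"
    if "b \<in> Obj (opposite B)" for b
  proof (intro bexI[of _ "c b"] conjI)
    have b: "b \<in> Obj B" using that by simp
    have maps: "restrict (\<lambda>u. snd (unpair u)) (fibre projection b) \<in> fibre projection b \<rightarrow>\<^sub>E ObjMap P b"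
      "restrict (\<lambda>x. pair (b, x)) (ObjMap P b) \<in> ObjMap P b \<rightarrow>\<^sub>E fibre projection b"
      using b by (auto simp: fibre_projection)
    have inverse: "compose (fibre projection b) (restrict (\<lambda>x. pair (b, x)) (ObjMap P b))
        (restrict (\<lambda>u. snd (unpair u)) (fibre projection b)) = restrict (\<lambda>x. x) (fibre projection b)"
      "compose (ObjMap P b) (restrict (\<lambda>u. snd (unpair u)) (fibre projection b))
        (restrict (\<lambda>x. pair (b, x)) (ObjMap P b)) = restrict (\<lambda>x. x) (ObjMap P b)"
      using b by (auto simp: fibre_projection compose_def intro!: restrict_ext)
    note s = small_P[OF b] small_fibre[OF U projection_DFib, of b]
    show "c b \<in> hom (Set_cat small) (ObjMap P b) (ObjMap (fibre_presheaf small projection) b)"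
      using b s maps by (simp add: c_def hom_Set_cat)
    show "Comp (Set_cat small) (c b) (At \<lparr>NDom = fibre_presheaf small projection, NCod = P,
      At = restrict a (Obj (opposite B))\<rparr> b) =
      Id (Set_cat small) (ObjMap (fibre_presheaf small projection) b)"
      using b s maps inverse by (simp add: a_def c_def)
    show "Comp (Set_cat small) (At \<lparr>NDom = fibre_presheaf small projection, NCod = P,
      At = restrict a (Obj (opposite B))\<rparr> b) (c b) = Id (Set_cat small) (ObjMap P b)"
      using b s maps inverse by (simp add: a_def c_def)
  qed
qed simp_all

end

theorem theorem2p1p2:
  fixes small :: "'u set \<Rightarrow> bool" and B :: "('u, 'u) cat"
  assumes "small_universe small" and "small_category small B"
  shows "equivalent_categories (DFib small B) (functor_category (opposite B) (Set_cat small))"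
proof (rule equivalent_categoriesI[OF fibre_functor[OF assms(1)]])
  fix p q assume pq: "p \<in> Obj (DFib small B)" "q \<in> Obj (DFib small B)"
  have "bij_betw (fibre_map small) (hom (DFib small B) p q)
    (hom (functor_category (opposite B) (Set_cat small)) (fibre_presheaf small p) (fibre_presheaf small q))"
    using inj_on_fibre_map fibre_map_hom[OF assms(1)] fibre_map_surj[OF assms(1) pq]
    by (fastforce simp: bij_betw_def)
  then show "bij_betw (ArrMap (fibre_functor small B)) (hom (DFib small B) p q)
      (hom (functor_category (opposite B) (Set_cat small))
        (ObjMap (fibre_functor small B) p) (ObjMap (fibre_functor small B) q))"
    using pq by (simp add: bij_betw_cong[OF fibre_functor_simps(2)])
next
  fix P assume "P \<in> Obj (functor_category (opposite B) (Set_cat small))"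
  moreover obtain pair :: "'u \<times> 'u \<Rightarrow> 'u" where "inj pair"
    using small_universe.pairing[OF assms(1)] by blast
  ultimately interpret presheaf B small P pair
    using assms by (simp add: presheaf_def presheaf_axioms_def small_category_def)
  show "\<exists>p \<in> Obj (DFib small B).
      isomorphic (functor_category (opposite B) (Set_cat small)) (ObjMap (fibre_functor small B) p) P"
    using fibre_presheaf_projection projection_DFib by (intro bexI[of _ projection]) auto
qed

end
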